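(* Let $\mathcal{E}$ be a category with dense generator $\mathcal{A}$. For any monad $T$ on $\mathcal{E}$ with arities $\mathcal{A}$, the full subcategory $\Theta_T$ of the Eilenberg-Moore category $\mathcal{E}^T$ spanned by the free $T$-algebras on the objects of $\mathcal{A}$ is a dense generator of $\mathcal{E}^T$. The essential image of the nerve functor $\nu_T:\mathcal{E}^T\to\widehat{\Theta_T}$ is spanned by those presheaves on $\Theta_T$ whose restriction along $j_T:\mathcal{A}\to\Theta_T$ belongs to the essential image of $\nu_{\mathcal{A}}:\mathcal{E}\to\widehat{\mathcal{A}}$.
   Context: All categories are locally small; $\widehat{\mathcal{A}}$ denotes the category of set-valued presheaves on $\mathcal{A}$. A dense generator of $\mathcal{E}$ is the inclusion $i_{\mathcal{A}}:\mathcal{A}\hookrightarrow\mathcal{E}$ of a small full subcategory such that the nerve functor $\nu_{\mathcal{A}}:\mathcal{E}\to\widehat{\mathcal{A}}$, $\nu_{\mathcal{A}}(X)(A)=\mathcal{E}(i_{\mathcal{A}}(A),X)$, is fully faithful. For an object $X$ of $\mathcal{E}$, $\mathcal{A}/X$ is the full subcategory of the slice category $\mathcal{E}/X$ on the arrows $A\to X$ with $A$ in $\mathcal{A}$; the $\mathcal{A}$-cocone over $X$ is the canonical natural transformation from the projection $\mathcal{A}/X\to\mathcal{E}$, $(A\to X)\mapsto A$, to the constant functor at $X$. A monad $T$ on $\mathcal{E}$ is a monad with arities $\mathcal{A}$ if $\nu_{\mathcal{A}}T$ takes the $\mathcal{A}$-cocones in $\mathcal{E}$ to colimit-cocones in $\widehat{\mathcal{A}}$.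 Let $F:\mathcal{E}\to\mathcal{E}^T$ be the free $T$-algebra functor. Write $i_T:\Theta_T\hookrightarrow\mathcal{E}^T$ for the full inclusion, $\nu_T=\mathcal{E}^T(i_T,-):\mathcal{E}^T\to\widehat{\Theta_T}$ for the associated nerve functor, and $j_T:\mathcal{A}\to\Theta_T$ for the unique functor with $i_Tj_T=Fi_{\mathcal{A}}$ (equivalently, $j_T$ and $i_T$ form the factorisation of $Fi_{\mathcal{A}}$ into a bijective-on-objects functor followed by a fully faithful functor). The essential image of a functor is the full subcategory of its codomain on the objects isomorphic to an object in its image. *)

theory Defs
  imports "HOL-Library.FuncSet" "HOL-Library.Equipollence"
begin

section \<open>Categories, functors, natural transformations\<close>

text \<open>
  Categories are given by families of hom-sets, which need not be disjoint; therefore composition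
  takes the objects involved as arguments: \<open>Comp C x y z g f\<close> is the composite of
  \<open>f : x \<rightarrow> y\<close> and \<open>g : y \<rightarrow> z\<close>. The values of \<open>Hom\<close>, \<open>Ident\<close> and \<open>Comp\<close> at arguments which are
  not objects (or arrows between them) are irrelevant.
\<close>

record ('o, 'a) cat =
  Obj :: "'o set"
  Hom :: "'o \<Rightarrow> 'o \<Rightarrow> 'a set"
  Ident :: "'o \<Rightarrow> 'a"
  Comp :: "'o \<Rightarrow> 'o \<Rightarrow> 'o \<Rightarrow> 'a \<Rightarrow> 'a \<Rightarrow> 'a"

locale category =
  fixes C :: "('o, 'a) cat"
  assumes Ident_in_Hom: "x \<in> Obj C \<Longrightarrow> Ident C x \<in> Hom C x x"
    and Comp_in_Hom: "\<lbrakk>x \<in> Obj C; y \<in> Obj C; z \<in> Obj C; f \<in> Hom C x y; g \<in> Hom C y z\<rbrakk>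
      \<Longrightarrow> Comp C x y z g f \<in> Hom C x z"
    and Comp_Ident_left: "\<lbrakk>x \<in> Obj C; y \<in> Obj C; f \<in> Hom C x y\<rbrakk>
      \<Longrightarrow> Comp C x y y (Ident C y) f = f"
    and Comp_Ident_right: "\<lbrakk>x \<in> Obj C; y \<in> Obj C; f \<in> Hom C x y\<rbrakk>
      \<Longrightarrow> Comp C x x y f (Ident C x) = f"
    and Comp_assoc: "\<lbrakk>w \<in> Obj C; x \<in> Obj C; y \<in> Obj C; z \<in> Obj C;
        f \<in> Hom C w x; g \<in> Hom C x y; h \<in> Hom C y z\<rbrakk>
      \<Longrightarrow> Comp C w x z (Comp C x y z h g) f = Comp C w y z h (Comp C w x y g f)"

definition op_cat :: "('o, 'a) cat \<Rightarrow> ('o, 'a) cat" where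
  "op_cat C = \<lparr>Obj = Obj C, Hom = (\<lambda>x y. Hom C y x), Ident = Ident C,
     Comp = (\<lambda>x y z g f. Comp C z y x f g)\<rparr>"

definition full_subcat :: "('o, 'a) cat \<Rightarrow> 'o set \<Rightarrow> ('o, 'a) cat" where
  "full_subcat C S = C\<lparr>Obj := S\<rparr>"

definition isomorphic :: "('o, 'a) cat \<Rightarrow> 'o \<Rightarrow> 'o \<Rightarrow> bool" where
  "isomorphic C x y \<longleftrightarrow> (\<exists>f\<in>Hom C x y. \<exists>g\<in>Hom C y x.
     Comp C x y x g f = Ident C x \<and> Comp C y x y f g = Ident C y)"

text \<open>
  Functors are extensional (\<open>undefined\<close> off the objects and arrows of their domain), so that
  equality of functors means what it should.
\<close>

record ('o, 'a, 'p, 'b) functor_data =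
  fobj :: "'o \<Rightarrow> 'p"
  farr :: "'o \<Rightarrow> 'o \<Rightarrow> 'a \<Rightarrow> 'b"

locale cat_functor = dom: category C + cod: category D
  for C :: "('o, 'a) cat" and D :: "('p, 'b) cat" and F :: "('o, 'a, 'p, 'b) functor_data" +
  assumes fobj_in: "x \<in> Obj C \<Longrightarrow> fobj F x \<in> Obj D"
    and farr_in: "\<lbrakk>x \<in> Obj C; y \<in> Obj C; f \<in> Hom C x y\<rbrakk>
      \<Longrightarrow> farr F x y f \<in> Hom D (fobj F x) (fobj F y)"
    and farr_Ident: "x \<in> Obj C \<Longrightarrow> farr F x x (Ident C x) = Ident D (fobj F x)"
    and farr_Comp: "\<lbrakk>x \<in> Obj C; y \<in> Obj C; z \<in> Obj C; f \<in> Hom C x y; g \<in> Hom C y z\<rbrakk>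
      \<Longrightarrow> farr F x z (Comp C x y z g f)
        = Comp D (fobj F x) (fobj F y) (fobj F z) (farr F y z g) (farr F x y f)"
    and fobj_ext: "x \<notin> Obj C \<Longrightarrow> fobj F x = undefined"
    and farr_ext: "\<not> (x \<in> Obj C \<and> y \<in> Obj C \<and> f \<in> Hom C x y) \<Longrightarrow> farr F x y f = undefined"

definition mk_functor ::
  "('o, 'a) cat \<Rightarrow> ('o \<Rightarrow> 'p) \<Rightarrow> ('o \<Rightarrow> 'o \<Rightarrow> 'a \<Rightarrow> 'b) \<Rightarrow> ('o, 'a, 'p, 'b) functor_data" where
  "mk_functor C F0 F1 = \<lparr>fobj = (\<lambda>x. if x \<in> Obj C then F0 x else undefined),
     farr = (\<lambda>x y f. if x \<in> Obj C \<and> y \<in> Obj C \<and> f \<in> Hom C x y then F1 x y f else undefined)\<rparr>"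

definition id_functor :: "('o, 'a) cat \<Rightarrow> ('o, 'a, 'o, 'a) functor_data" where
  "id_functor C = mk_functor C (\<lambda>x. x) (\<lambda>x y f. f)"

definition const_functor :: "('o, 'a) cat \<Rightarrow> ('p, 'b) cat \<Rightarrow> 'p \<Rightarrow> ('o, 'a, 'p, 'b) functor_data"
  where "const_functor C D d = mk_functor C (\<lambda>x. d) (\<lambda>x y f. Ident D d)"

text \<open>\<open>comp_functor C G F\<close> is the composite of \<open>F\<close>, with domain \<open>C\<close>, followed by \<open>G\<close>.\<close>

definition comp_functor :: "('o, 'a) cat \<Rightarrow> ('p, 'b, 'q, 'c) functor_data
    \<Rightarrow> ('o, 'a, 'p, 'b) functor_data \<Rightarrow> ('o, 'a, 'q, 'c) functor_data" where
  "comp_functor C G F = mk_functor C (\<lambda>x. fobj G (fobj F x))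
     (\<lambda>x y f. farr G (fobj F x) (fobj F y) (farr F x y f))"

definition op_functor :: "('o, 'a, 'p, 'b) functor_data \<Rightarrow> ('o, 'a, 'p, 'b) functor_data" where
  "op_functor F = \<lparr>fobj = fobj F, farr = (\<lambda>x y. farr F y x)\<rparr>"

definition fully_faithful ::
  "('o, 'a) cat \<Rightarrow> ('p, 'b) cat \<Rightarrow> ('o, 'a, 'p, 'b) functor_data \<Rightarrow> bool" where
  "fully_faithful C D F \<longleftrightarrow> cat_functor C D F \<and>
     (\<forall>x\<in>Obj C. \<forall>y\<in>Obj C. bij_betw (farr F x y) (Hom C x y) (Hom D (fobj F x) (fobj F y)))"

definition ess_image ::
  "('o, 'a) cat \<Rightarrow> ('p, 'b) cat \<Rightarrow> ('o, 'a, 'p, 'b) functor_data \<Rightarrow> ('p, 'b) cat" where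
  "ess_image C D F = full_subcat D {d \<in> Obj D. \<exists>x\<in>Obj C. isomorphic D d (fobj F x)}"

locale nat_trans = source: cat_functor C D F + target: cat_functor C D G
  for C :: "('o, 'a) cat" and D :: "('p, 'b) cat"
    and F G :: "('o, 'a, 'p, 'b) functor_data" and \<tau> :: "'o \<Rightarrow> 'b" +
  assumes component_in: "x \<in> Obj C \<Longrightarrow> \<tau> x \<in> Hom D (fobj F x) (fobj G x)"
    and naturality: "\<lbrakk>x \<in> Obj C; y \<in> Obj C; f \<in> Hom C x y\<rbrakk>
      \<Longrightarrow> Comp D (fobj F x) (fobj F y) (fobj G y) (\<tau> y) (farr F x y f)
        = Comp D (fobj F x) (fobj G x) (fobj G y) (farr G x y f) (\<tau> x)"
    and component_ext: "\<tau> \<in> extensional (Obj C)"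

definition functor_cat ::
  "('o, 'a) cat \<Rightarrow> ('p, 'b) cat \<Rightarrow> (('o, 'a, 'p, 'b) functor_data, 'o \<Rightarrow> 'b) cat" where
  "functor_cat C D = \<lparr>Obj = {F. cat_functor C D F},
     Hom = (\<lambda>F G. {\<tau>. nat_trans C D F G \<tau>}),
     Ident = (\<lambda>F. \<lambda>x\<in>Obj C. Ident D (fobj F x)),
     Comp = (\<lambda>F G H \<tau> \<sigma>. \<lambda>x\<in>Obj C. Comp D (fobj F x) (fobj G x) (fobj H x) (\<tau> x) (\<sigma> x))\<rparr>"

text \<open>\<open>whisker J H G G' \<tau>\<close> is the image under \<open>H\<close> of \<open>\<tau> : G \<Rightarrow> G'\<close>, where \<open>G\<close> and \<open>G'\<close> have
  domain \<open>J\<close>.\<close>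

definition whisker :: "('j, 'k) cat \<Rightarrow> ('o, 'a, 'p, 'b) functor_data
    \<Rightarrow> ('j, 'k, 'o, 'a) functor_data \<Rightarrow> ('j, 'k, 'o, 'a) functor_data
    \<Rightarrow> ('j \<Rightarrow> 'a) \<Rightarrow> 'j \<Rightarrow> 'b" where
  "whisker J H G G' \<tau> = (\<lambda>j\<in>Obj J. farr H (fobj G j) (fobj G' j) (\<tau> j))"

definition colimit_cocone :: "('j, 'k) cat \<Rightarrow> ('o, 'a) cat \<Rightarrow> ('j, 'k, 'o, 'a) functor_data
    \<Rightarrow> 'o \<Rightarrow> ('j \<Rightarrow> 'a) \<Rightarrow> bool" where
  "colimit_cocone J C G c \<tau> \<longleftrightarrow> c \<in> Obj C \<and> nat_trans J C G (const_functor J C c) \<tau> \<and>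
     (\<forall>d\<in>Obj C. \<forall>\<sigma>. nat_trans J C G (const_functor J C d) \<sigma> \<longrightarrow>
        (\<exists>!h. h \<in> Hom C c d \<and> (\<forall>j\<in>Obj J. Comp C (fobj G j) c d h (\<tau> j) = \<sigma> j)))"


section \<open>Sets, smallness and presheaves\<close>

text \<open>
  Smallness is relative to a type \<open>'u\<close>: a set is small if its cardinality is strictly less than that
  of \<open>'u\<close>, and the category of sets consists of the small subsets of \<open>'u\<close>. If the cardinality of
  \<open>'u\<close> is inaccessible, this is up to equivalence the category of sets of a Grothendieck universe;
  no closure property of \<open>'u\<close> is assumed anywhere. A locally small category has its arrows in
  \<open>'u\<close>, so that its hom-sets are objects of the category of sets. As hom-sets need not be disjoint,
  every category with small hom-sets is isomorphic to one of this form.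
\<close>

definition set_cat :: "('u set, 'u \<Rightarrow> 'u) cat" where
  "set_cat = \<lparr>Obj = {X. X \<prec> (UNIV :: 'u set)}, Hom = (\<lambda>X Y. X \<rightarrow>\<^sub>E Y),
     Ident = (\<lambda>X. \<lambda>x\<in>X. x), Comp = (\<lambda>X Y Z g f. compose X g f)\<rparr>"

definition locally_small :: "('o, 'u) cat \<Rightarrow> bool" where
  "locally_small C \<longleftrightarrow> category C \<and> (\<forall>x\<in>Obj C. \<forall>y\<in>Obj C. Hom C x y \<prec> (UNIV :: 'u set))"

definition small_category :: "('o, 'u) cat \<Rightarrow> bool" where
  "small_category C \<longleftrightarrow> locally_small C \<and> Obj C \<prec> (UNIV :: 'u set)"

type_synonym ('o, 'u) presheaf = "('o, 'u, 'u set, 'u \<Rightarrow> 'u) functor_data"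

definition presheaf_cat :: "('o, 'u) cat \<Rightarrow> (('o, 'u) presheaf, 'o \<Rightarrow> 'u \<Rightarrow> 'u) cat" where
  "presheaf_cat A = functor_cat (op_cat A) set_cat"

text \<open>Restriction of a presheaf along \<open>j\<close>, where \<open>j\<close> has domain \<open>A\<close>.\<close>

definition restrict_presheaf :: "('o, 'u) cat \<Rightarrow> ('o, 'u, 'p, 'u) functor_data
    \<Rightarrow> ('p, 'u) presheaf \<Rightarrow> ('o, 'u) presheaf" where
  "restrict_presheaf A j P = comp_functor (op_cat A) P (op_functor j)"


section \<open>Nerves and dense generators\<close>

text \<open>A full subcategory is represented by its set \<open>S\<close> of objects. In the following, the arrow
  \<open>g : B \<rightarrow> A\<close> of \<open>S\<close> is an arrow from \<open>A\<close> to \<open>B\<close> of the opposite category.\<close>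

definition nerve_presheaf :: "('o, 'u) cat \<Rightarrow> 'o set \<Rightarrow> 'o \<Rightarrow> ('o, 'u) presheaf" where
  "nerve_presheaf E S X = mk_functor (op_cat (full_subcat E S)) (\<lambda>A. Hom E A X)
     (\<lambda>A B g. \<lambda>f\<in>Hom E A X. Comp E B A X f g)"

definition nerve :: "('o, 'u) cat \<Rightarrow> 'o set
    \<Rightarrow> ('o, 'u, ('o, 'u) presheaf, 'o \<Rightarrow> 'u \<Rightarrow> 'u) functor_data" where
  "nerve E S = mk_functor E (nerve_presheaf E S)
     (\<lambda>X Y h. \<lambda>A\<in>S. \<lambda>f\<in>Hom E A X. Comp E A X Y h f)"

definition dense_generator :: "('o, 'u) cat \<Rightarrow> 'o set \<Rightarrow> bool" where
  "dense_generator E S \<longleftrightarrow> locally_small E \<and> S \<subseteq> Obj E \<and> small_category (full_subcat E S) \<and>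
     fully_faithful E (presheaf_cat (full_subcat E S)) (nerve E S)"

definition inclusion :: "('o, 'u) cat \<Rightarrow> 'o set \<Rightarrow> ('o, 'u, 'o, 'u) functor_data" where
  "inclusion E S = mk_functor (full_subcat E S) (\<lambda>x. x) (\<lambda>x y f. f)"


section \<open>Monads and their algebras\<close>

record ('o, 'a) monad_data =
  endo :: "('o, 'a, 'o, 'a) functor_data"
  munit :: "'o \<Rightarrow> 'a"
  mmult :: "'o \<Rightarrow> 'a"

locale monad =
  fixes E :: "('o, 'a) cat" and T :: "('o, 'a) monad_data"
  assumes endo_functor: "cat_functor E E (endo T)"
    and munit_nat: "nat_trans E E (id_functor E) (endo T) (munit T)"
    and mmult_nat: "nat_trans E E (comp_functor E (endo T) (endo T)) (endo T) (mmult T)"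
    and munit_left: "\<And>X TX. \<lbrakk>X \<in> Obj E; TX = fobj (endo T) X\<rbrakk>
      \<Longrightarrow> Comp E TX (fobj (endo T) TX) TX (mmult T X) (munit T TX) = Ident E TX"
    and munit_right: "\<And>X TX. \<lbrakk>X \<in> Obj E; TX = fobj (endo T) X\<rbrakk>
      \<Longrightarrow> Comp E TX (fobj (endo T) TX) TX (mmult T X) (farr (endo T) X TX (munit T X)) = Ident E TX"
    and mmult_assoc: "\<And>X TX TTX TTTX. \<lbrakk>X \<in> Obj E; TX = fobj (endo T) X; TTX = fobj (endo T) TX;
        TTTX = fobj (endo T) TTX\<rbrakk>
      \<Longrightarrow> Comp E TTTX TTX TX (mmult T X) (mmult T TX)
        = Comp E TTTX TTX TX (mmult T X) (farr (endo T) TTX TX (mmult T X))"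

definition em_algebra :: "('o, 'a) cat \<Rightarrow> ('o, 'a) monad_data \<Rightarrow> 'o \<times> 'a \<Rightarrow> bool" where
  "em_algebra E T = (\<lambda>(X, a). let TX = fobj (endo T) X; TTX = fobj (endo T) TX in
     X \<in> Obj E \<and> a \<in> Hom E TX X \<and>
     Comp E X TX X a (munit T X) = Ident E X \<and>
     Comp E TTX TX X a (mmult T X) = Comp E TTX TX X a (farr (endo T) TX X a))"

definition em_hom :: "('o, 'a) cat \<Rightarrow> ('o, 'a) monad_data \<Rightarrow> 'o \<times> 'a \<Rightarrow> 'o \<times> 'a \<Rightarrow> 'a set" where
  "em_hom E T = (\<lambda>(X, a) (Y, b). {h \<in> Hom E X Y.
     Comp E (fobj (endo T) X) X Y h a
       = Comp E (fobj (endo T) X) (fobj (endo T) Y) Y b (farr (endo T) X Y h)})"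

definition em_cat :: "('o, 'a) cat \<Rightarrow> ('o, 'a) monad_data \<Rightarrow> ('o \<times> 'a, 'a) cat" where
  "em_cat E T = \<lparr>Obj = {Xa. em_algebra E T Xa}, Hom = em_hom E T,
     Ident = (\<lambda>(X, a). Ident E X),
     Comp = (\<lambda>(X, a) (Y, b) (Z, c) g f. Comp E X Y Z g f)\<rparr>"

definition free_algebra ::
  "('o, 'a) cat \<Rightarrow> ('o, 'a) monad_data \<Rightarrow> ('o, 'a, 'o \<times> 'a, 'a) functor_data" where
  "free_algebra E T = mk_functor E (\<lambda>X. (fobj (endo T) X, mmult T X)) (farr (endo T))"

definition Theta_objs :: "('o, 'a) cat \<Rightarrow> 'o set \<Rightarrow> ('o, 'a) monad_data \<Rightarrow> ('o \<times> 'a) set" where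
  "Theta_objs E S T = fobj (free_algebra E T) ` S"

definition Theta :: "('o, 'a) cat \<Rightarrow> 'o set \<Rightarrow> ('o, 'a) monad_data \<Rightarrow> ('o \<times> 'a, 'a) cat" where
  "Theta E S T = full_subcat (em_cat E T) (Theta_objs E S T)"

text \<open>The functor from \<open>S\<close> to \<open>Theta E S T\<close> whose composite with the full inclusion into the category
  of algebras is the restriction to \<open>S\<close> of the free algebra functor. Since functors do not record
  their codomain, it has the same underlying data as that restriction.\<close>

definition theory_functor :: "('o, 'a) cat \<Rightarrow> 'o set \<Rightarrow> ('o, 'a) monad_data
    \<Rightarrow> ('o, 'a, 'o \<times> 'a, 'a) functor_data" where
  "theory_functor E S T = comp_functor (full_subcat E S) (free_algebra E T) (inclusion E S)"


section \<open>Monads with arities\<close>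

definition slice_cat :: "('o, 'a) cat \<Rightarrow> 'o \<Rightarrow> ('o \<times> 'a, 'a) cat" where
  "slice_cat E X = \<lparr>Obj = {(A, f). A \<in> Obj E \<and> f \<in> Hom E A X},
     Hom = (\<lambda>(A, f) (B, g). {h \<in> Hom E A B. Comp E A B X g h = f}),
     Ident = (\<lambda>(A, f). Ident E A),
     Comp = (\<lambda>(A, f) (B, g) (D, k) v u. Comp E A B D v u)\<rparr>"

definition slice_over :: "('o, 'a) cat \<Rightarrow> 'o set \<Rightarrow> 'o \<Rightarrow> ('o \<times> 'a, 'a) cat" where
  "slice_over E S X = full_subcat (slice_cat E X) {(A, f). A \<in> S \<and> f \<in> Hom E A X}"

definition slice_proj :: "('o, 'a) cat \<Rightarrow> 'o set \<Rightarrow> 'o \<Rightarrow> ('o \<times> 'a, 'a, 'o, 'a) functor_data" where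
  "slice_proj E S X = mk_functor (slice_over E S X) fst (\<lambda>x y h. h)"

definition canonical_cocone :: "('o, 'a) cat \<Rightarrow> 'o set \<Rightarrow> 'o \<Rightarrow> 'o \<times> 'a \<Rightarrow> 'a" where
  "canonical_cocone E S X = (\<lambda>Af\<in>Obj (slice_over E S X). snd Af)"

definition monad_with_arities :: "('o, 'u) cat \<Rightarrow> 'o set \<Rightarrow> ('o, 'u) monad_data \<Rightarrow> bool" where
  "monad_with_arities E S T \<longleftrightarrow> monad E T \<and>
     (\<forall>X\<in>Obj E.
        let J = slice_over E S X; \<nu>T = comp_functor E (nerve E S) (endo T) in
        colimit_cocone J (presheaf_cat (full_subcat E S))
          (comp_functor J \<nu>T (slice_proj E S X)) (fobj \<nu>T X)
          (whisker J \<nu>T (slice_proj E S X) (const_functor J E X) (canonical_cocone E S X)))"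

end

theory Submission
  imports Defs
begin

text \<open>
  Homomorphisms from the free algebra \<open>F A\<close> to an algebra \<open>(X, a)\<close> correspond to arrows
  \<open>x : A \<rightarrow> X\<close>, by \<open>x \<mapsto> a \<circ> T x\<close>. Hence the restriction along \<open>j\<^sub>T\<close> of the nerve of \<open>(X, a)\<close> is
  isomorphic to the nerve of \<open>X\<close>, while the homomorphisms \<open>F B \<rightarrow> F A\<close>, which correspond to the
  arrows \<open>y : B \<rightarrow> T A\<close>, act on its elements by \<open>x \<mapsto> a \<circ> T x \<circ> y\<close>. The arity condition says that
  morphisms from the nerve of \<open>T X\<close> are determined by, and can be prescribed (compatibly) on, the
  elements \<open>T x \<circ> y\<close>. Therefore this action determines \<open>a\<close>, and \<open>a\<close> can be constructed from a
  presheaf whose restriction is isomorphic to the nerve of \<open>X\<close>.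

  In detail, a natural transformation between nerves of algebras yields an arrow \<open>h\<close> of \<open>E\<close> by density
  of \<open>S\<close>, and \<open>h\<close> is a homomorphism because this can be tested on the \<open>T x \<circ> y\<close> (\<open>dense_Theta\<close>).
  Given a presheaf whose restriction is isomorphic to the nerve of \<open>X\<close>, the arity condition and
  density provide \<open>a : T X \<rightarrow> X\<close> (\<open>restriction_representedD\<close>). Its associativity is an equation
  between arrows out of \<open>T (T X)\<close>, to be tested on \<open>T (T x)\<close> for \<open>x : A \<rightarrow> X\<close>. That these are jointly
  epic (\<open>TT_jointly_epi\<close>) follows by applying the arity condition at \<open>T X\<close> and, with values in the
  presheaf \<open>B \<mapsto> E (T B, Y)\<close>, at \<open>X\<close>.

  The colimits of the arity condition are used only through their universal property with respect to
  presheaves of small sets. No colimit has to be constructed, and none has to be computed pointwise,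
  so that no closure properties of the category of small sets are needed.
\<close>

section \<open>Categories and presheaves\<close>

lemma op_cat_simps [simp]:
  "Obj (op_cat C) = Obj C" "Hom (op_cat C) x y = Hom C y x" "Ident (op_cat C) x = Ident C x"
  "Comp (op_cat C) x y z g f = Comp C z y x f g"
  by (simp_all add: op_cat_def)

lemma full_subcat_simps [simp]:
  "Obj (full_subcat C S) = S" "Hom (full_subcat C S) = Hom C" "Ident (full_subcat C S) = Ident C"
  "Comp (full_subcat C S) = Comp C"
  by (simp_all add: full_subcat_def)

lemma set_cat_simps [simp]:
  "Obj set_cat = {X :: 'u set. X \<prec> (UNIV :: 'u set)}" "Hom set_cat X Y = X \<rightarrow>\<^sub>E Y"
  "Ident set_cat X = (\<lambda>x\<in>X. x)" "Comp set_cat X Y Z g f = compose X g f"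
  by (simp_all add: set_cat_def)

lemma functor_cat_simps [simp]:
  "Obj (functor_cat C D) = {F. cat_functor C D F}" "Hom (functor_cat C D) F G = {\<tau>. nat_trans C D F G \<tau>}"
  "Ident (functor_cat C D) F = (\<lambda>x\<in>Obj C. Ident D (fobj F x))"
  "Comp (functor_cat C D) F G H \<tau> \<sigma> =
    (\<lambda>x\<in>Obj C. Comp D (fobj F x) (fobj G x) (fobj H x) (\<tau> x) (\<sigma> x))"
  by (simp_all add: functor_cat_def)

lemma mk_functor_fobj [simp]: "x \<in> Obj C \<Longrightarrow> fobj (mk_functor C F0 F1) x = F0 x"
  by (simp add: mk_functor_def)

lemma mk_functor_farr [simp]:
  "\<lbrakk>x \<in> Obj C; y \<in> Obj C; f \<in> Hom C x y\<rbrakk> \<Longrightarrow> farr (mk_functor C F0 F1) x y f = F1 x y f"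
  by (simp add: mk_functor_def)

lemma category_op_cat: "category C \<Longrightarrow> category (op_cat C)"
  unfolding category_def by simp

lemma category_full_subcat: "\<lbrakk>category C; S \<subseteq> Obj C\<rbrakk> \<Longrightarrow> category (full_subcat C S)"
  unfolding category_def by (simp add: subset_iff)

lemma category_set_cat: "category set_cat"
  by unfold_locales (auto simp: compose_def PiE_iff extensional_def fun_eq_iff)

lemma category_functor_cat:
  assumes "category C" and "category D"
  shows "category (functor_cat C D)"
proof -
  interpret C: category C by fact
  interpret D: category D by fact
  show ?thesis
  proof
    fix F assume "F \<in> Obj (functor_cat C D)"
    then interpret F: cat_functor C D F by simp
    show "Ident (functor_cat C D) F \<in> Hom (functor_cat C D) F F"
      by (simp, unfold_locales)
        (auto simp: F.fobj_in F.farr_in D.Ident_in_Hom D.Comp_Ident_left D.Comp_Ident_right)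
  next
    fix F G H \<tau> \<sigma>
    assume "\<tau> \<in> Hom (functor_cat C D) F G" "\<sigma> \<in> Hom (functor_cat C D) G H"
    then interpret \<tau>: nat_trans C D F G \<tau> + \<sigma>: nat_trans C D G H \<sigma> by simp_all
    show "Comp (functor_cat C D) F G H \<sigma> \<tau> \<in> Hom (functor_cat C D) F H"
    proof (simp, unfold_locales)
      fix x y f assume A: "x \<in> Obj C" "y \<in> Obj C" "f \<in> Hom C x y"
      note [simp] = A \<tau>.component_in \<sigma>.component_in \<tau>.source.fobj_in \<tau>.target.fobj_in
        \<sigma>.target.fobj_in \<tau>.source.farr_in \<tau>.target.farr_in \<sigma>.target.farr_in D.Comp_in_Hom
      show "Comp D (fobj F x) (fobj F y) (fobj H y)
          ((\<lambda>x\<in>Obj C. Comp D (fobj F x) (fobj G x) (fobj H x) (\<sigma> x) (\<tau> x)) y) (farr F x y f) =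
        Comp D (fobj F x) (fobj H x) (fobj H y) (farr H x y f)
          ((\<lambda>x\<in>Obj C. Comp D (fobj F x) (fobj G x) (fobj H x) (\<sigma> x) (\<tau> x)) x)"
        by (simp add: D.Comp_assoc \<tau>.naturality)
          (simp flip: D.Comp_assoc add: \<sigma>.naturality)
    qed (auto simp: D.Comp_in_Hom \<tau>.component_in \<sigma>.component_in \<tau>.source.fobj_in
        \<tau>.target.fobj_in \<sigma>.target.fobj_in)
  next
    fix F G \<tau>
    assume "\<tau> \<in> Hom (functor_cat C D) F G"
    then interpret \<tau>: nat_trans C D F G \<tau> by simp
    show "Comp (functor_cat C D) F G G (Ident (functor_cat C D) G) \<tau> = \<tau>"
      by (rule extensionalityI[OF _ \<tau>.component_ext])
        (simp_all add: D.Comp_Ident_left \<tau>.component_in \<tau>.source.fobj_in \<tau>.target.fobj_in)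
    show "Comp (functor_cat C D) F F G \<tau> (Ident (functor_cat C D) F) = \<tau>"
      by (rule extensionalityI[OF _ \<tau>.component_ext])
        (simp_all add: D.Comp_Ident_right \<tau>.component_in \<tau>.source.fobj_in \<tau>.target.fobj_in)
  next
    fix F G H K \<tau> \<sigma> \<rho>
    assume "\<tau> \<in> Hom (functor_cat C D) F G" "\<sigma> \<in> Hom (functor_cat C D) G H"
      "\<rho> \<in> Hom (functor_cat C D) H K"
    then interpret \<tau>: nat_trans C D F G \<tau> + \<sigma>: nat_trans C D G H \<sigma> + \<rho>: nat_trans C D H K \<rho>
      by simp_all
    show "Comp (functor_cat C D) F G K (Comp (functor_cat C D) G H K \<rho> \<sigma>) \<tau> =
        Comp (functor_cat C D) F H K \<rho> (Comp (functor_cat C D) F G H \<sigma> \<tau>)"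
      by (rule extensionalityI[where A = "Obj C"])
        (simp_all add: D.Comp_assoc \<tau>.component_in \<sigma>.component_in \<rho>.component_in
          \<tau>.source.fobj_in \<tau>.target.fobj_in \<sigma>.target.fobj_in \<rho>.target.fobj_in)
  qed
qed

lemma category_presheaf_cat: "category A \<Longrightarrow> category (presheaf_cat A)"
  unfolding presheaf_cat_def by (intro category_functor_cat category_op_cat category_set_cat)

lemma mk_presheaf:
  assumes "category A"
    and "\<And>x. x \<in> Obj A \<Longrightarrow> F0 x \<prec> (UNIV :: 'u set)"
    and "\<And>x y f. \<lbrakk>x \<in> Obj A; y \<in> Obj A; f \<in> Hom A y x\<rbrakk> \<Longrightarrow> F1 x y f \<in> F0 x \<rightarrow>\<^sub>E F0 y"
    and "\<And>x e. \<lbrakk>x \<in> Obj A; e \<in> F0 x\<rbrakk> \<Longrightarrow> F1 x x (Ident A x) e = e"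
    and "\<And>x y z f g e. \<lbrakk>x \<in> Obj A; y \<in> Obj A; z \<in> Obj A; f \<in> Hom A y x; g \<in> Hom A z y; e \<in> F0 x\<rbrakk>
      \<Longrightarrow> F1 x z (Comp A z y x f g) e = F1 y z g (F1 x y f e)"
  shows "mk_functor (op_cat A) F0 F1 \<in> Obj (presheaf_cat (A :: ('o, 'u) cat))"
proof -
  interpret A: category A by fact
  have "cat_functor (op_cat A) set_cat (mk_functor (op_cat A) F0 F1)"
  proof (intro cat_functor.intro cat_functor_axioms.intro)
    show "category (op_cat A)" by (rule category_op_cat) fact
    show "category set_cat" by (rule category_set_cat)
    fix x assume x: "x \<in> Obj (op_cat A)"
    have "F1 x x (Ident A x) = (\<lambda>e\<in>F0 x. e)"
      by (rule extensionalityI[where A = "F0 x"])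
        (use x assms(3)[of x x "Ident A x"] assms(4) A.Ident_in_Hom in \<open>auto simp: PiE_iff\<close>)
    then show "farr (mk_functor (op_cat A) F0 F1) x x (Ident (op_cat A) x) =
        Ident set_cat (fobj (mk_functor (op_cat A) F0 F1) x)"
      using x A.Ident_in_Hom by simp
  next
    fix x y z f g
    assume h: "x \<in> Obj (op_cat A)" "y \<in> Obj (op_cat A)" "z \<in> Obj (op_cat A)"
      "f \<in> Hom (op_cat A) x y" "g \<in> Hom (op_cat A) y z"
    then have c: "Comp A z y x f g \<in> Hom A z x"
      using A.Comp_in_Hom by simp
    have "F1 x z (Comp A z y x f g) = compose (F0 x) (F1 y z g) (F1 x y f)"
      by (rule extensionalityI[where A = "F0 x"])
        (use h c assms(3)[of x z "Comp A z y x f g"] assms(5)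
          in \<open>auto simp: PiE_iff compose_def\<close>)
    then show "farr (mk_functor (op_cat A) F0 F1) x z (Comp (op_cat A) x y z g f) =
        Comp set_cat (fobj (mk_functor (op_cat A) F0 F1) x) (fobj (mk_functor (op_cat A) F0 F1) y)
          (fobj (mk_functor (op_cat A) F0 F1) z) (farr (mk_functor (op_cat A) F0 F1) y z g)
          (farr (mk_functor (op_cat A) F0 F1) x y f)"
      using h c by simp
  qed (use assms(2,3) in \<open>auto simp: mk_functor_def\<close>)
  then show ?thesis by (simp add: presheaf_cat_def)
qed

context
  fixes A :: "('o, 'u) cat" and P :: "('o, 'u) presheaf"
  assumes P: "P \<in> Obj (presheaf_cat A)"
begin

interpretation P: cat_functor "op_cat A" set_cat P
  using P by (simp add: presheaf_cat_def)

lemma presheaf_small: "x \<in> Obj A \<Longrightarrow> fobj P x \<prec> (UNIV :: 'u set)"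
  using P.fobj_in by simp

lemma presheaf_funcset:
  "\<lbrakk>x \<in> Obj A; y \<in> Obj A; f \<in> Hom A y x\<rbrakk> \<Longrightarrow> farr P x y f \<in> fobj P x \<rightarrow>\<^sub>E fobj P y"
  using P.farr_in by simp

lemma presheaf_in:
  "\<lbrakk>x \<in> Obj A; y \<in> Obj A; f \<in> Hom A y x; e \<in> fobj P x\<rbrakk> \<Longrightarrow> farr P x y f e \<in> fobj P y"
  using presheaf_funcset by blast

lemma presheaf_Ident: "\<lbrakk>x \<in> Obj A; e \<in> fobj P x\<rbrakk> \<Longrightarrow> farr P x x (Ident A x) e = e"
  using P.farr_Ident[of x] by simp

lemma presheaf_Comp:
  "\<lbrakk>x \<in> Obj A; y \<in> Obj A; z \<in> Obj A; f \<in> Hom A y x; g \<in> Hom A z y; e \<in> fobj P x\<rbrakk>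
    \<Longrightarrow> farr P x z (Comp A z y x f g) e = farr P y z g (farr P x y f e)"
  using P.farr_Comp[of x y z f g] by (simp add: compose_def)

end

text \<open>Morphisms of presheaves, in terms of elements.\<close>

lemma presheaf_hom_iff:
  assumes "P \<in> Obj (presheaf_cat A)" and "Q \<in> Obj (presheaf_cat A)"
  shows "\<tau> \<in> Hom (presheaf_cat A) P Q \<longleftrightarrow>
    \<tau> \<in> extensional (Obj A) \<and> (\<forall>x\<in>Obj A. \<tau> x \<in> fobj P x \<rightarrow>\<^sub>E fobj Q x) \<and>
    (\<forall>x\<in>Obj A. \<forall>y\<in>Obj A. \<forall>f\<in>Hom A y x. \<forall>e\<in>fobj P x.
      \<tau> y (farr P x y f e) = farr Q x y f (\<tau> x e))" (is "_ \<longleftrightarrow> ?R")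
proof -
  have PQ: "cat_functor (op_cat A) set_cat P" "cat_functor (op_cat A) set_cat Q"
    using assms by (simp_all add: presheaf_cat_def)
  have "compose (fobj P x) (\<tau> y) (farr P x y f) = compose (fobj P x) (farr Q x y f) (\<tau> x) \<longleftrightarrow>
    (\<forall>e\<in>fobj P x. \<tau> y (farr P x y f e) = farr Q x y f (\<tau> x e))" for x y f
    unfolding compose_def fun_eq_iff restrict_def by auto
  then show ?thesis
    unfolding presheaf_cat_def nat_trans_def nat_trans_axioms_def functor_cat_simps
    using PQ by auto
qed

lemma presheaf_homI:
  assumes "P \<in> Obj (presheaf_cat A)" and "Q \<in> Obj (presheaf_cat A)"
    and "\<And>x e. \<lbrakk>x \<in> Obj A; e \<in> fobj P x\<rbrakk> \<Longrightarrow> \<tau> x e \<in> fobj Q x"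
    and "\<And>x y f e. \<lbrakk>x \<in> Obj A; y \<in> Obj A; f \<in> Hom A y x; e \<in> fobj P x\<rbrakk>
      \<Longrightarrow> \<tau> y (farr P x y f e) = farr Q x y f (\<tau> x e)"
  shows "(\<lambda>x\<in>Obj A. \<lambda>e\<in>fobj P x. \<tau> x e) \<in> Hom (presheaf_cat A) P Q"
  unfolding presheaf_hom_iff[OF assms(1,2)]
  using assms(3,4) presheaf_in[OF assms(1)] by auto

text \<open>An isomorphism of presheaves is a natural transformation with bijective components.\<close>

lemma presheaf_isomorphic_iff:
  assumes "P \<in> Obj (presheaf_cat A)" and "Q \<in> Obj (presheaf_cat A)"
  shows "isomorphic (presheaf_cat A) P Q \<longleftrightarrow>
    (\<exists>\<tau>\<in>Hom (presheaf_cat A) P Q. \<forall>x\<in>Obj A. bij_betw (\<tau> x) (fobj P x) (fobj Q x))"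
proof
  assume "isomorphic (presheaf_cat A) P Q"
  then obtain f g where fg: "f \<in> Hom (presheaf_cat A) P Q" "g \<in> Hom (presheaf_cat A) Q P"
    and gf: "Comp (presheaf_cat A) P Q P g f = Ident (presheaf_cat A) P"
    and fg': "Comp (presheaf_cat A) Q P Q f g = Ident (presheaf_cat A) Q"
    unfolding isomorphic_def by blast
  have "bij_betw (f x) (fobj P x) (fobj Q x)" if x: "x \<in> Obj A" for x
  proof (rule bij_betw_byWitness[where f' = "g x"])
    have "compose (fobj P x) (g x) (f x) = (\<lambda>e\<in>fobj P x. e)"
      using fun_cong[OF gf, of x] x by (simp add: presheaf_cat_def)
    then show "\<forall>e\<in>fobj P x. g x (f x e) = e"
      by (metis compose_eq restrict_apply')
    have "compose (fobj Q x) (f x) (g x) = (\<lambda>e\<in>fobj Q x. e)"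
      using fun_cong[OF fg', of x] x by (simp add: presheaf_cat_def)
    then show "\<forall>e\<in>fobj Q x. f x (g x e) = e"
      by (metis compose_eq restrict_apply')
  qed (use fg x presheaf_hom_iff[OF assms] presheaf_hom_iff[OF assms(2,1)] in \<open>auto simp: PiE_iff\<close>)
  with fg(1) show "\<exists>\<tau>\<in>Hom (presheaf_cat A) P Q. \<forall>x\<in>Obj A. bij_betw (\<tau> x) (fobj P x) (fobj Q x)"
    by blast
next
  assume "\<exists>\<tau>\<in>Hom (presheaf_cat A) P Q. \<forall>x\<in>Obj A. bij_betw (\<tau> x) (fobj P x) (fobj Q x)"
  then obtain \<tau> where \<tau>: "\<tau> \<in> Hom (presheaf_cat A) P Q"
    and bij: "\<And>x. x \<in> Obj A \<Longrightarrow> bij_betw (\<tau> x) (fobj P x) (fobj Q x)"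
    by blast
  note \<tau>' = \<tau>[unfolded presheaf_hom_iff[OF assms]]
  define \<sigma> where "\<sigma> x = inv_into (fobj P x) (\<tau> x)" for x
  have \<sigma>_in: "\<sigma> x e \<in> fobj P x" and \<tau>\<sigma>: "\<tau> x (\<sigma> x e) = e" if "x \<in> Obj A" "e \<in> fobj Q x" for x e
    unfolding \<sigma>_def using bij[OF that(1)] that(2)
    by (auto simp: bij_betw_def inv_into_into f_inv_into_f)
  have \<sigma>\<tau>: "\<sigma> x (\<tau> x e) = e" if "x \<in> Obj A" "e \<in> fobj P x" for x e
    unfolding \<sigma>_def using bij[OF that(1)] that(2) by (rule bij_betw_inv_into_left)
  define \<sigma>' where "\<sigma>' = (\<lambda>x\<in>Obj A. \<lambda>e\<in>fobj Q x. \<sigma> x e)"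
  have "\<sigma>' \<in> Hom (presheaf_cat A) Q P"
    unfolding \<sigma>'_def
  proof (rule presheaf_homI[OF assms(2,1) \<sigma>_in])
    fix x y f e assume h: "x \<in> Obj A" "y \<in> Obj A" "f \<in> Hom A y x" "e \<in> fobj Q x"
    have "farr Q x y f e = \<tau> y (farr P x y f (\<sigma> x e))"
      using \<tau>' \<tau>\<sigma>[OF h(1,4)] \<sigma>_in[OF h(1,4)] h by simp
    then show "\<sigma> y (farr Q x y f e) = farr P x y f (\<sigma> x e)"
      using \<sigma>\<tau> presheaf_in[OF assms(1) h(1-3) \<sigma>_in] h by simp
  qed
  moreover have "Comp (presheaf_cat A) P Q P \<sigma>' \<tau> = Ident (presheaf_cat A) P"
    "Comp (presheaf_cat A) Q P Q \<tau> \<sigma>' = Ident (presheaf_cat A) Q"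
    using \<tau>' by (auto simp: presheaf_cat_def compose_def \<sigma>'_def \<sigma>\<tau> \<tau>\<sigma> fun_eq_iff restrict_def PiE_iff)
  ultimately show "isomorphic (presheaf_cat A) P Q"
    unfolding isomorphic_def using \<tau> by blast
qed

section \<open>Nerves\<close>

lemma nerve_presheaf_simps [simp]:
  "A \<in> S \<Longrightarrow> fobj (nerve_presheaf E S X) A = Hom E A X"
  "\<lbrakk>A \<in> S; B \<in> S; g \<in> Hom E B A; f \<in> Hom E A X\<rbrakk>
    \<Longrightarrow> farr (nerve_presheaf E S X) A B g f = Comp E B A X f g"
  by (simp_all add: nerve_presheaf_def)

lemma nerve_presheaf_in:
  assumes "locally_small E" and "S \<subseteq> Obj E" and "X \<in> Obj E"
  shows "nerve_presheaf E S X \<in> Obj (presheaf_cat (full_subcat E S))"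
proof -
  interpret category E using assms(1) by (simp add: locally_small_def)
  show ?thesis
    unfolding nerve_presheaf_def
  proof (rule mk_presheaf)
    show "category (full_subcat E S)"
      by (rule category_full_subcat) (unfold_locales, fact)
  qed (use assms in \<open>auto simp: locally_small_def Comp_in_Hom Comp_Ident_right Comp_assoc subset_iff\<close>)
qed

text \<open>Families of elements of \<open>Q\<close> indexed by the arrows from objects of \<open>S\<close> to \<open>X\<close>, naturally in
  the latter. They represent the morphisms of presheaves from the nerve of \<open>X\<close> to \<open>Q\<close> irrespective
  of values off the domain.\<close>

definition nerve_family :: "('o, 'u) cat \<Rightarrow> 'o set \<Rightarrow> 'o \<Rightarrow> ('o, 'u) presheaf
    \<Rightarrow> ('o \<Rightarrow> 'u \<Rightarrow> 'u) \<Rightarrow> bool" where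
  "nerve_family E S X Q \<phi> \<longleftrightarrow>
    (\<forall>A\<in>S. \<forall>f\<in>Hom E A X. \<phi> A f \<in> fobj Q A) \<and>
    (\<forall>A\<in>S. \<forall>B\<in>S. \<forall>f\<in>Hom E A X. \<forall>g\<in>Hom E B A. \<phi> B (Comp E B A X f g) = farr Q A B g (\<phi> A f))"

lemma nerve_hom_iff:
  assumes "locally_small E" and "S \<subseteq> Obj E" and "X \<in> Obj E"
    and "Q \<in> Obj (presheaf_cat (full_subcat E S))"
  shows "\<tau> \<in> Hom (presheaf_cat (full_subcat E S)) (nerve_presheaf E S X) Q \<longleftrightarrow>
    \<tau> \<in> extensional S \<and> (\<forall>A\<in>S. \<tau> A \<in> extensional (Hom E A X)) \<and> nerve_family E S X Q \<tau>"
  unfolding presheaf_hom_iff[OF nerve_presheaf_in[OF assms(1-3)] assms(4)] nerve_family_def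
  by (auto simp: PiE_iff)

lemma nerve_familyD:
  assumes "nerve_family E S X Q \<phi>"
  shows "\<lbrakk>A \<in> S; f \<in> Hom E A X\<rbrakk> \<Longrightarrow> \<phi> A f \<in> fobj Q A"
    and "\<lbrakk>A \<in> S; B \<in> S; f \<in> Hom E A X; g \<in> Hom E B A\<rbrakk>
      \<Longrightarrow> \<phi> B (Comp E B A X f g) = farr Q A B g (\<phi> A f)"
  using assms unfolding nerve_family_def by blast+

lemma nerve_hom_restrict:
  assumes "locally_small E" and "S \<subseteq> Obj E" and "X \<in> Obj E"
    and "Q \<in> Obj (presheaf_cat (full_subcat E S))" and "nerve_family E S X Q \<phi>"
  shows "(\<lambda>A\<in>S. \<lambda>f\<in>Hom E A X. \<phi> A f) \<in> Hom (presheaf_cat (full_subcat E S)) (nerve_presheaf E S X) Q"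
proof -
  interpret category E using assms(1) by (simp add: locally_small_def)
  show ?thesis
    unfolding nerve_hom_iff[OF assms(1-4)] nerve_family_def
    using nerve_familyD[OF assms(5)] assms(2,3) by (auto simp: Comp_in_Hom subset_iff)
qed

lemma nerve_functor:
  assumes "locally_small E" and "S \<subseteq> Obj E"
  shows "cat_functor E (presheaf_cat (full_subcat E S)) (nerve E S)"
proof -
  interpret category E using assms(1) by (simp add: locally_small_def)
  have cat: "category (full_subcat E S)"
    by (rule category_full_subcat) (unfold_locales, fact)
  note S = subsetD[OF assms(2)]
  note in_psh = nerve_presheaf_in[OF assms]
  show ?thesis
  proof (intro cat_functor.intro cat_functor_axioms.intro category_axioms
      category_presheaf_cat[OF cat])
    fix X Y h assume h: "X \<in> Obj E" "Y \<in> Obj E" "h \<in> Hom E X Y"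
    have "nerve_family E S X (nerve_presheaf E S Y) (\<lambda>A f. Comp E A X Y h f)"
      unfolding nerve_family_def using h S by (auto simp: Comp_in_Hom Comp_assoc)
    from nerve_hom_restrict[OF assms h(1) in_psh[OF h(2)] this]
    show "farr (nerve E S) X Y h \<in> Hom (presheaf_cat (full_subcat E S))
        (fobj (nerve E S) X) (fobj (nerve E S) Y)"
      using h by (simp add: nerve_def)
  next
    fix X Y Z h k
    assume h: "X \<in> Obj E" "Y \<in> Obj E" "Z \<in> Obj E" "h \<in> Hom E X Y" "k \<in> Hom E Y Z"
    have "(\<lambda>f\<in>Hom E A X. Comp E A X Z (Comp E X Y Z k h) f) =
      compose (Hom E A X) (\<lambda>f\<in>Hom E A Y. Comp E A Y Z k f) (\<lambda>f\<in>Hom E A X. Comp E A X Y h f)"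
      if "A \<in> S" for A
      unfolding compose_def using h S[OF that] by (auto simp: Comp_in_Hom Comp_assoc)
    then show "farr (nerve E S) X Z (Comp E X Y Z k h) =
      Comp (presheaf_cat (full_subcat E S)) (fobj (nerve E S) X) (fobj (nerve E S) Y)
        (fobj (nerve E S) Z) (farr (nerve E S) Y Z k) (farr (nerve E S) X Y h)"
      using h by (auto simp: nerve_def presheaf_cat_def Comp_in_Hom)
  next
    fix X assume X: "X \<in> Obj E"
    then show "farr (nerve E S) X X (Ident E X) =
        Ident (presheaf_cat (full_subcat E S)) (fobj (nerve E S) X)"
      using S by (auto simp: nerve_def presheaf_cat_def Ident_in_Hom Comp_Ident_left fun_eq_iff restrict_def)
  qed (use in_psh in \<open>auto simp: nerve_def mk_functor_def\<close>)
qed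

text \<open>Full faithfulness of the nerve functor, in terms of elements: the arrows from objects of \<open>S\<close> are
  jointly epic, and natural families are given by composition.\<close>

lemma nerve_fully_faithful_iff:
  assumes "locally_small E" and "S \<subseteq> Obj E"
  shows "fully_faithful E (presheaf_cat (full_subcat E S)) (nerve E S) \<longleftrightarrow>
    (\<forall>X\<in>Obj E. \<forall>Y\<in>Obj E.
      (\<forall>h\<in>Hom E X Y. \<forall>k\<in>Hom E X Y.
        (\<forall>A\<in>S. \<forall>f\<in>Hom E A X. Comp E A X Y h f = Comp E A X Y k f) \<longrightarrow> h = k) \<and>
      (\<forall>\<phi>. nerve_family E S X (nerve_presheaf E S Y) \<phi> \<longrightarrow>
        (\<exists>h\<in>Hom E X Y. \<forall>A\<in>S. \<forall>f\<in>Hom E A X. \<phi> A f = Comp E A X Y h f)))"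
proof -
  let ?P = "presheaf_cat (full_subcat E S)" and ?N = "nerve E S"
  have "bij_betw (farr ?N X Y) (Hom E X Y) (Hom ?P (fobj ?N X) (fobj ?N Y)) \<longleftrightarrow>
      (\<forall>h\<in>Hom E X Y. \<forall>k\<in>Hom E X Y.
        (\<forall>A\<in>S. \<forall>f\<in>Hom E A X. Comp E A X Y h f = Comp E A X Y k f) \<longrightarrow> h = k) \<and>
      (\<forall>\<phi>. nerve_family E S X (nerve_presheaf E S Y) \<phi> \<longrightarrow>
        (\<exists>h\<in>Hom E X Y. \<forall>A\<in>S. \<forall>f\<in>Hom E A X. \<phi> A f = Comp E A X Y h f))"
    (is "?B \<longleftrightarrow> ?I \<and> ?F") if X: "X \<in> Obj E" and Y: "Y \<in> Obj E" for X Y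
  proof -
    have farr: "farr ?N X Y h = (\<lambda>A\<in>S. \<lambda>f\<in>Hom E A X. Comp E A X Y h f)" if "h \<in> Hom E X Y" for h
      using X Y that by (simp add: nerve_def)
    have eq: "farr ?N X Y h = \<tau> \<longleftrightarrow> (\<forall>A\<in>S. \<forall>f\<in>Hom E A X. Comp E A X Y h f = \<tau> A f)"
      if "h \<in> Hom E X Y" "\<tau> \<in> extensional S" "\<And>A. A \<in> S \<Longrightarrow> \<tau> A \<in> extensional (Hom E A X)" for h \<tau>
    proof
      assume R: "\<forall>A\<in>S. \<forall>f\<in>Hom E A X. Comp E A X Y h f = \<tau> A f"
      have "(\<lambda>f\<in>Hom E A X. Comp E A X Y h f) = \<tau> A" if "A \<in> S" for A
        by (rule extensionalityI[where A = "Hom E A X"]) (use that R \<open>\<And>A. A \<in> S \<Longrightarrow> \<tau> A \<in> _\<close> in auto)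
      then show "farr ?N X Y h = \<tau>"
        by (intro extensionalityI[where A = S]) (use farr that in auto)
    qed (use farr that in auto)
    have inj: "inj_on (farr ?N X Y) (Hom E X Y) \<longleftrightarrow> ?I"
    proof -
      have "farr ?N X Y h = farr ?N X Y k \<longleftrightarrow>
          (\<forall>A\<in>S. \<forall>f\<in>Hom E A X. Comp E A X Y h f = Comp E A X Y k f)"
        if "h \<in> Hom E X Y" "k \<in> Hom E X Y" for h k
        by (subst eq) (use that farr in auto)
      then show ?thesis by (auto simp: inj_on_def)
    qed
    have N: "fobj ?N X = nerve_presheaf E S X" "fobj ?N Y = nerve_presheaf E S Y"
      using X Y by (simp_all add: nerve_def)
    interpret N: cat_functor E ?P ?N by (rule nerve_functor[OF assms])
    have sub: "farr ?N X Y ` Hom E X Y \<subseteq> Hom ?P (fobj ?N X) (fobj ?N Y)"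
      using N.farr_in X Y by auto
    have surj: "Hom ?P (fobj ?N X) (fobj ?N Y) \<subseteq> farr ?N X Y ` Hom E X Y \<longleftrightarrow> ?F"
    proof
      assume L: "Hom ?P (fobj ?N X) (fobj ?N Y) \<subseteq> farr ?N X Y ` Hom E X Y"
      show ?F
      proof (intro allI impI)
        fix \<phi> assume "nerve_family E S X (nerve_presheaf E S Y) \<phi>"
        from nerve_hom_restrict[OF assms X nerve_presheaf_in[OF assms Y] this] L
        obtain h where h: "h \<in> Hom E X Y" "(\<lambda>A\<in>S. \<lambda>f\<in>Hom E A X. \<phi> A f) = farr ?N X Y h"
          unfolding N by blast
        then show "\<exists>h\<in>Hom E X Y. \<forall>A\<in>S. \<forall>f\<in>Hom E A X. \<phi> A f = Comp E A X Y h f"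
          using eq[OF h(1), of "\<lambda>A\<in>S. \<lambda>f\<in>Hom E A X. \<phi> A f"] by (metis (lifting) restrict_apply'
              restrict_extensional)
      qed
    next
      assume R: ?F
      show "Hom ?P (fobj ?N X) (fobj ?N Y) \<subseteq> farr ?N X Y ` Hom E X Y"
      proof
        fix \<tau> assume "\<tau> \<in> Hom ?P (fobj ?N X) (fobj ?N Y)"
        then have \<tau>: "\<tau> \<in> extensional S" "\<And>A. A \<in> S \<Longrightarrow> \<tau> A \<in> extensional (Hom E A X)"
          "nerve_family E S X (nerve_presheaf E S Y) \<tau>"
          unfolding N nerve_hom_iff[OF assms X nerve_presheaf_in[OF assms Y]] by auto
        with R obtain h where "h \<in> Hom E X Y" "\<forall>A\<in>S. \<forall>f\<in>Hom E A X. \<tau> A f = Comp E A X Y h f"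
          by blast
        then show "\<tau> \<in> farr ?N X Y ` Hom E X Y"
          using eq[OF _ \<tau>(1,2)] by (metis imageI)
      qed
    qed
    show ?thesis
      unfolding bij_betw_def using inj sub surj by blast
  qed
  then show ?thesis
    unfolding fully_faithful_def using nerve_functor[OF assms] by simp
qed


section \<open>Monads with arities\<close>

lemma (in category) Comp_eq_precomp:
  assumes "Comp C x y z g f = Comp C x y' z g' f'"
    and "w \<in> Obj C" "x \<in> Obj C" "y \<in> Obj C" "y' \<in> Obj C" "z \<in> Obj C"
    and "f \<in> Hom C x y" "g \<in> Hom C y z" "f' \<in> Hom C x y'" "g' \<in> Hom C y' z" "h \<in> Hom C w x"
  shows "Comp C w y z g (Comp C w x y f h) = Comp C w y' z g' (Comp C w x y' f' h)"
  by (subst (1 2) Comp_assoc[symmetric]) (use assms in simp_all)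

text \<open>A monad together with the functor and naturality properties of its constituents.\<close>

locale monad_on_category = category E + monad E T + T: cat_functor E E "endo T"
  + unit: nat_trans E E "id_functor E" "endo T" "munit T"
  + mult: nat_trans E E "comp_functor E (endo T) (endo T)" "endo T" "mmult T"
  for E :: "('o, 'u) cat" and T
begin

text \<open>\<open>T0\<close> and \<open>T1\<close> are the actions of the endofunctor on objects and on arrows.\<close>

abbreviation T0 where "T0 \<equiv> fobj (endo T)"
abbreviation T1 where "T1 \<equiv> farr (endo T)"
abbreviation \<eta> where "\<eta> \<equiv> munit T"
abbreviation \<mu> where "\<mu> \<equiv> mmult T"

lemmas [simp] = Ident_in_Hom Comp_in_Hom Comp_Ident_left Comp_Ident_right T.fobj_in T.farr_in
  T.farr_Ident

lemma eta_in [simp]: "X \<in> Obj E \<Longrightarrow> \<eta> X \<in> Hom E X (T0 X)"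
  using unit.component_in[of X] by (simp add: id_functor_def)

lemma eta_nat:
  "\<lbrakk>X \<in> Obj E; Y \<in> Obj E; f \<in> Hom E X Y\<rbrakk>
    \<Longrightarrow> Comp E X Y (T0 Y) (\<eta> Y) f = Comp E X (T0 X) (T0 Y) (T1 X Y f) (\<eta> X)"
  using unit.naturality[of X Y f] by (simp add: id_functor_def)

lemma mu_in [simp]: "X \<in> Obj E \<Longrightarrow> \<mu> X \<in> Hom E (T0 (T0 X)) (T0 X)"
  using mult.component_in[of X] by (simp add: comp_functor_def)

lemma mu_nat:
  "\<lbrakk>X \<in> Obj E; Y \<in> Obj E; f \<in> Hom E X Y\<rbrakk>
    \<Longrightarrow> Comp E (T0 (T0 X)) (T0 (T0 Y)) (T0 Y) (\<mu> Y) (T1 (T0 X) (T0 Y) (T1 X Y f))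
      = Comp E (T0 (T0 X)) (T0 X) (T0 Y) (T1 X Y f) (\<mu> X)"
  using mult.naturality[of X Y f] by (simp add: comp_functor_def)

end

lemma monad_on_category: "monad E T \<Longrightarrow> monad_on_category E T"
  unfolding monad_on_category_def using cat_functor.axioms(1) monad.endo_functor monad.munit_nat
    monad.mmult_nat by blast

text \<open>A monad with arities \<open>S\<close> on a category with dense generator \<open>S\<close>.\<close>

locale arities_monad = monad_on_category E T
  for E :: "('o, 'u) cat" and T :: "('o, 'u) monad_data" +
  fixes S :: "'o set"
  assumes dense: "dense_generator E S" and arity_condition: "monad_with_arities E S T"
begin

lemma locally_small: "locally_small E" and S_sub: "S \<subseteq> Obj E"
  using dense by (simp_all add: dense_generator_def)

lemma S_Obj [simp]: "A \<in> S \<Longrightarrow> A \<in> Obj E"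
  using S_sub by blast

lemmas nerve_in [simp] = nerve_presheaf_in[OF locally_small S_sub]

lemma dense_eq:
  assumes "X \<in> Obj E" "Y \<in> Obj E" "h \<in> Hom E X Y" "k \<in> Hom E X Y"
    and "\<And>A f. \<lbrakk>A \<in> S; f \<in> Hom E A X\<rbrakk> \<Longrightarrow> Comp E A X Y h f = Comp E A X Y k f"
  shows "h = k"
  using dense assms unfolding dense_generator_def nerve_fully_faithful_iff[OF locally_small S_sub]
  by blast

lemma dense_represented:
  assumes "X \<in> Obj E" "Y \<in> Obj E" and "nerve_family E S X (nerve_presheaf E S Y) \<phi>"
  obtains h where "h \<in> Hom E X Y" "\<And>A f. \<lbrakk>A \<in> S; f \<in> Hom E A X\<rbrakk> \<Longrightarrow> \<phi> A f = Comp E A X Y h f"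
  using dense assms unfolding dense_generator_def nerve_fully_faithful_iff[OF locally_small S_sub]
  by blast

text \<open>The universal property of the nerve of \<open>T X\<close> as a colimit: a morphism to a presheaf \<open>Q\<close> is
  given by its values on the composites of arrows \<open>y : B \<rightarrow> T A\<close> with images under \<open>T\<close> of arrows
  \<open>x : A \<rightarrow> X\<close>.\<close>

lemma arities_ex1:
  assumes X: "X \<in> Obj E" and Q: "Q \<in> Obj (presheaf_cat (full_subcat E S))"
    and fam: "\<And>A x. \<lbrakk>A \<in> S; x \<in> Hom E A X\<rbrakk> \<Longrightarrow> nerve_family E S (T0 A) Q (\<sigma> A x)"
    and compat: "\<And>A A' x u B y. \<lbrakk>A \<in> S; A' \<in> S; x \<in> Hom E A X; u \<in> Hom E A' A; B \<in> S;
        y \<in> Hom E B (T0 A')\<rbrakk>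
      \<Longrightarrow> \<sigma> A' (Comp E A' A X x u) B y = \<sigma> A x B (Comp E B (T0 A') (T0 A) (T1 A' A u) y)"
  shows "\<exists>!h. h \<in> Hom (presheaf_cat (full_subcat E S)) (nerve_presheaf E S (T0 X)) Q \<and>
    (\<forall>A\<in>S. \<forall>x\<in>Hom E A X. \<forall>B\<in>S. \<forall>y\<in>Hom E B (T0 A).
      h B (Comp E B (T0 A) (T0 X) (T1 A X x) y) = \<sigma> A x B y)"
proof -
  define J where "J = slice_over E S X"
  define D where "D = comp_functor J (comp_functor E (nerve E S) (endo T)) (slice_proj E S X)"
  define w where "w = whisker J (comp_functor E (nerve E S) (endo T)) (slice_proj E S X)
    (const_functor J E X) (canonical_cocone E S X)"
  let ?P = "presheaf_cat (full_subcat E S)"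
  have nT: "fobj (comp_functor E (nerve E S) (endo T)) Z = nerve_presheaf E S (T0 Z)"
    if "Z \<in> Obj E" for Z
    using that by (simp add: comp_functor_def nerve_def)
  have nT1: "farr (comp_functor E (nerve E S) (endo T)) Z W f =
      (\<lambda>B\<in>S. \<lambda>y\<in>Hom E B (T0 Z). Comp E B (T0 Z) (T0 W) (T1 Z W f) y)"
    if "Z \<in> Obj E" "W \<in> Obj E" "f \<in> Hom E Z W" for Z W f
    using that by (simp add: comp_functor_def nerve_def)
  have colim: "colimit_cocone J ?P D (nerve_presheaf E S (T0 X)) w"
    using arity_condition X unfolding monad_with_arities_def J_def D_def w_def Let_def
    by (simp add: nT)
  have J_Obj: "Obj J = {(A, f). A \<in> S \<and> f \<in> Hom E A X}"
    by (simp add: J_def slice_over_def)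
  have J_Hom: "Hom J (A, f) (B, g) = {h \<in> Hom E A B. Comp E A B X g h = f}" for A f B g
    by (simp add: J_def slice_over_def slice_cat_def)
  have D0: "fobj D (A, x) = nerve_presheaf E S (T0 A)" if "A \<in> S" "x \<in> Hom E A X" for A x
    using that J_Obj by (simp add: D_def comp_functor_def[of J] slice_proj_def J_def[symmetric] nT)
  have D1: "farr D (A', Comp E A' A X x u) (A, x) u =
      (\<lambda>B\<in>S. \<lambda>y\<in>Hom E B (T0 A'). Comp E B (T0 A') (T0 A) (T1 A' A u) y)"
    if "A \<in> S" "A' \<in> S" "x \<in> Hom E A X" "u \<in> Hom E A' A" for A x A' u
    using that J_Obj J_Hom X
    by (simp add: D_def comp_functor_def[of J] slice_proj_def J_def[symmetric] nT1)
  have w: "w (A, x) = (\<lambda>B\<in>S. \<lambda>y\<in>Hom E B (T0 A). Comp E B (T0 A) (T0 X) (T1 A X x) y)"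
    if "A \<in> S" "x \<in> Hom E A X" for A x
    using that X J_Obj
    by (simp add: w_def whisker_def slice_proj_def const_functor_def canonical_cocone_def
        J_def[symmetric] nT1)
  interpret w: nat_trans J ?P D "const_functor J ?P (nerve_presheaf E S (T0 X))" w
    using colim by (simp add: colimit_cocone_def)
  define \<tau> where "\<tau> = (\<lambda>(A, x)\<in>Obj J. \<lambda>B\<in>S. \<lambda>y\<in>Hom E B (T0 A). \<sigma> A x B y)"
  have \<tau>_in: "(\<lambda>B\<in>S. \<lambda>y\<in>Hom E B (T0 A). \<sigma> A x B y) \<in> Hom ?P (nerve_presheaf E S (T0 A)) Q"
    if "A \<in> S" "x \<in> Hom E A X" for A x
    using nerve_hom_restrict[OF locally_small S_sub _ Q fam[OF that]] that by simp
  have const: "cat_functor J ?P (const_functor J ?P Q)"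
    by unfold_locales
      (use Q in \<open>auto simp: const_functor_def mk_functor_def w.source.dom.Ident_in_Hom
          w.source.dom.Comp_in_Hom w.source.cod.Ident_in_Hom w.source.cod.Comp_Ident_left\<close>)
  have "nat_trans J ?P D (const_functor J ?P Q) \<tau>"
  proof (intro nat_trans.intro nat_trans_axioms.intro w.source.cat_functor_axioms const)
    fix j assume "j \<in> Obj J"
    then show "\<tau> j \<in> Hom ?P (fobj D j) (fobj (const_functor J ?P Q) j)"
      using \<tau>_in by (auto simp: \<tau>_def J_Obj D0 const_functor_def)
  next
    fix j' j u assume j: "j' \<in> Obj J" "j \<in> Obj J" "u \<in> Hom J j' j"
    obtain A' x' A x where [simp]: "j' = (A', x')" "j = (A, x)" by (cases j', cases j)
    have h: "A \<in> S" "A' \<in> S" "x \<in> Hom E A X" "u \<in> Hom E A' A" "x' = Comp E A' A X x u"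
      using j by (auto simp: J_Obj J_Hom)
    have x': "x' \<in> Hom E A' X" using h X by simp
    have \<tau>j: "\<tau> j = (\<lambda>B\<in>S. \<lambda>y\<in>Hom E B (T0 A). \<sigma> A x B y)"
      "\<tau> j' = (\<lambda>B\<in>S. \<lambda>y\<in>Hom E B (T0 A'). \<sigma> A' x' B y)"
      using j by (simp_all add: \<tau>_def)
    have "\<tau> j' \<in> Hom ?P (nerve_presheaf E S (T0 A')) Q"
      using \<tau>_in[OF h(2) x'] \<tau>j by simp
    then have "Comp ?P (nerve_presheaf E S (T0 A')) Q Q (Ident ?P Q) (\<tau> j') = \<tau> j'"
      using w.source.cod.Comp_Ident_left[of "nerve_presheaf E S (T0 A')" Q "\<tau> j'"] Q h by simp
    moreover have "Comp ?P (nerve_presheaf E S (T0 A')) (nerve_presheaf E S (T0 A)) Q (\<tau> j)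
        (\<lambda>B\<in>S. \<lambda>y\<in>Hom E B (T0 A'). Comp E B (T0 A') (T0 A) (T1 A' A u) y) = \<tau> j'"
      unfolding \<tau>j using h compat
      by (auto simp: presheaf_cat_def compose_def fun_eq_iff restrict_def)
    ultimately show "Comp ?P (fobj D j') (fobj D j) (fobj (const_functor J ?P Q) j) (\<tau> j)
        (farr D j' j u) =
      Comp ?P (fobj D j') (fobj (const_functor J ?P Q) j') (fobj (const_functor J ?P Q) j)
        (farr (const_functor J ?P Q) j' j u) (\<tau> j')"
      using h x' j D1 by (simp add: D0 const_functor_def)
  qed (simp add: \<tau>_def)
  with colim Q have "\<exists>!h. h \<in> Hom ?P (nerve_presheaf E S (T0 X)) Q \<and>
      (\<forall>j\<in>Obj J. Comp ?P (fobj D j) (nerve_presheaf E S (T0 X)) Q h (w j) = \<tau> j)"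
    by (simp add: colimit_cocone_def)
  moreover have "(\<forall>j\<in>Obj J. Comp ?P (fobj D j) (nerve_presheaf E S (T0 X)) Q h (w j) = \<tau> j) \<longleftrightarrow>
      (\<forall>A\<in>S. \<forall>x\<in>Hom E A X. \<forall>B\<in>S. \<forall>y\<in>Hom E B (T0 A).
        h B (Comp E B (T0 A) (T0 X) (T1 A X x) y) = \<sigma> A x B y)" for h
  proof -
    have "Comp ?P (fobj D (A, x)) (nerve_presheaf E S (T0 X)) Q h (w (A, x)) = \<tau> (A, x) \<longleftrightarrow>
        (\<forall>B\<in>S. \<forall>y\<in>Hom E B (T0 A). h B (Comp E B (T0 A) (T0 X) (T1 A X x) y) = \<sigma> A x B y)"
      if "A \<in> S" "x \<in> Hom E A X" for A x
      using that J_Obj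
      by (auto simp: D0 w \<tau>_def presheaf_cat_def compose_def fun_eq_iff restrict_def)
    then show ?thesis by (auto simp: J_Obj)
  qed
  ultimately show ?thesis by simp
qed

lemma arities_exists:
  assumes X: "X \<in> Obj E" and Q: "Q \<in> Obj (presheaf_cat (full_subcat E S))"
    and fam: "\<And>A x. \<lbrakk>A \<in> S; x \<in> Hom E A X\<rbrakk> \<Longrightarrow> nerve_family E S (T0 A) Q (\<sigma> A x)"
    and compat: "\<And>A A' x u B y. \<lbrakk>A \<in> S; A' \<in> S; x \<in> Hom E A X; u \<in> Hom E A' A; B \<in> S;
        y \<in> Hom E B (T0 A')\<rbrakk>
      \<Longrightarrow> \<sigma> A' (Comp E A' A X x u) B y = \<sigma> A x B (Comp E B (T0 A') (T0 A) (T1 A' A u) y)"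
  obtains \<phi> where "nerve_family E S (T0 X) Q \<phi>"
    "\<And>A x B y. \<lbrakk>A \<in> S; x \<in> Hom E A X; B \<in> S; y \<in> Hom E B (T0 A)\<rbrakk>
      \<Longrightarrow> \<phi> B (Comp E B (T0 A) (T0 X) (T1 A X x) y) = \<sigma> A x B y"
proof -
  from arities_ex1[of X Q \<sigma>, OF assms]
  obtain h where h: "h \<in> Hom (presheaf_cat (full_subcat E S)) (nerve_presheaf E S (T0 X)) Q"
    "\<forall>A\<in>S. \<forall>x\<in>Hom E A X. \<forall>B\<in>S. \<forall>y\<in>Hom E B (T0 A).
      h B (Comp E B (T0 A) (T0 X) (T1 A X x) y) = \<sigma> A x B y"
    by auto
  show ?thesis
    using h nerve_hom_iff[OF locally_small S_sub _ Q] X by (intro that[of h]) auto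
qed

lemma arities_unique:
  assumes X: "X \<in> Obj E" and Q: "Q \<in> Obj (presheaf_cat (full_subcat E S))"
    and fam: "nerve_family E S (T0 X) Q \<phi>" "nerve_family E S (T0 X) Q \<psi>"
    and eq: "\<And>A x B y. \<lbrakk>A \<in> S; x \<in> Hom E A X; B \<in> S; y \<in> Hom E B (T0 A)\<rbrakk>
      \<Longrightarrow> \<phi> B (Comp E B (T0 A) (T0 X) (T1 A X x) y) = \<psi> B (Comp E B (T0 A) (T0 X) (T1 A X x) y)"
    and B: "B \<in> S" "w \<in> Hom E B (T0 X)"
  shows "\<phi> B w = \<psi> B w"
proof -
  let ?P = "presheaf_cat (full_subcat E S)"
  define \<sigma> where "\<sigma> A x B y = \<phi> B (Comp E B (T0 A) (T0 X) (T1 A X x) y)" for A x B y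
  have "\<exists>!h. h \<in> Hom ?P (nerve_presheaf E S (T0 X)) Q \<and>
    (\<forall>A\<in>S. \<forall>x\<in>Hom E A X. \<forall>B\<in>S. \<forall>y\<in>Hom E B (T0 A).
      h B (Comp E B (T0 A) (T0 X) (T1 A X x) y) = \<sigma> A x B y)" (is "\<exists>!h. ?C h")
  proof (rule arities_ex1[OF X Q])
    fix A x assume A: "A \<in> S" "x \<in> Hom E A X"
    show "nerve_family E S (T0 A) Q (\<sigma> A x)"
      unfolding nerve_family_def \<sigma>_def
      using A X nerve_familyD[OF fam(1)] by (simp flip: Comp_assoc)
  next
    fix A A' x u B y assume "A \<in> S" "A' \<in> S" "x \<in> Hom E A X" "u \<in> Hom E A' A" "B \<in> S"
      "y \<in> Hom E B (T0 A')"
    then show "\<sigma> A' (Comp E A' A X x u) B y = \<sigma> A x B (Comp E B (T0 A') (T0 A) (T1 A' A u) y)"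
      using X by (simp add: \<sigma>_def T.farr_Comp Comp_assoc)
  qed
  moreover have "?C (\<lambda>A\<in>S. \<lambda>f\<in>Hom E A (T0 X). \<chi> A f)"
    if "nerve_family E S (T0 X) Q \<chi>"
      "\<And>A x B y. \<lbrakk>A \<in> S; x \<in> Hom E A X; B \<in> S; y \<in> Hom E B (T0 A)\<rbrakk>
        \<Longrightarrow> \<chi> B (Comp E B (T0 A) (T0 X) (T1 A X x) y) = \<sigma> A x B y" for \<chi>
    using nerve_hom_restrict[OF locally_small S_sub _ Q that(1)] that(2) X by simp
  from this[OF fam(1)] this[OF fam(2)]
  have "?C (\<lambda>A\<in>S. \<lambda>f\<in>Hom E A (T0 X). \<phi> A f)" "?C (\<lambda>A\<in>S. \<lambda>f\<in>Hom E A (T0 X). \<psi> A f)"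
    using eq by (simp_all add: \<sigma>_def)
  ultimately have "(\<lambda>A\<in>S. \<lambda>f\<in>Hom E A (T0 X). \<phi> A f) = (\<lambda>A\<in>S. \<lambda>f\<in>Hom E A (T0 X). \<psi> A f)"
    by blast
  from fun_cong[OF this, of B] have "(\<lambda>f\<in>Hom E B (T0 X). \<phi> B f) = (\<lambda>f\<in>Hom E B (T0 X). \<psi> B f)"
    using B by simp
  from fun_cong[OF this, of w] show ?thesis
    using B by simp
qed

lemma T_jointly_epi:
  assumes "X \<in> Obj E" "Y \<in> Obj E" and p: "p \<in> Hom E (T0 X) Y" "q \<in> Hom E (T0 X) Y"
    and "\<And>A x. \<lbrakk>A \<in> S; x \<in> Hom E A X\<rbrakk>
      \<Longrightarrow> Comp E (T0 A) (T0 X) Y p (T1 A X x) = Comp E (T0 A) (T0 X) Y q (T1 A X x)"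
  shows "p = q"
proof (rule dense_eq[OF _ assms(2) p])
  have fam: "nerve_family E S (T0 X) (nerve_presheaf E S Y) (\<lambda>A f. Comp E A (T0 X) Y h f)"
    if "h \<in> Hom E (T0 X) Y" for h
    unfolding nerve_family_def using that assms by (simp add: Comp_assoc)
  fix B w assume B: "B \<in> S" "w \<in> Hom E B (T0 X)"
  show "Comp E B (T0 X) Y p w = Comp E B (T0 X) Y q w"
  proof (rule arities_unique[OF assms(1) nerve_in[OF assms(2)] fam[OF p(1)] fam[OF p(2)] _ B])
    fix A x B y assume "A \<in> S" "x \<in> Hom E A X" "B \<in> S" "y \<in> Hom E B (T0 A)"
    then show "Comp E B (T0 X) Y p (Comp E B (T0 A) (T0 X) (T1 A X x) y) =
        Comp E B (T0 X) Y q (Comp E B (T0 A) (T0 X) (T1 A X x) y)"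
      using assms by (simp flip: Comp_assoc)
  qed
qed (use assms in simp)

text \<open>The arrows \<open>T (T x)\<close> are jointly epic, too. The arity condition at \<open>T X\<close> reduces the claim
  to the composites of \<open>p\<close> and \<open>q\<close> with \<open>T y\<close> for \<open>y : B \<rightarrow> T X\<close>. Now \<open>p \<circ> T y\<close> is the value at \<open>y\<close>
  of a morphism from the nerve of \<open>T X\<close> to the presheaf \<open>B \<mapsto> E (T B, Y)\<close>, so that the arity condition
  at \<open>X\<close> applies.\<close>

lemma TT_jointly_epi:
  assumes X: "X \<in> Obj E" and Y: "Y \<in> Obj E"
    and p: "p \<in> Hom E (T0 (T0 X)) Y" and q: "q \<in> Hom E (T0 (T0 X)) Y"
    and eq: "\<And>A x. \<lbrakk>A \<in> S; x \<in> Hom E A X\<rbrakk>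
      \<Longrightarrow> Comp E (T0 (T0 A)) (T0 (T0 X)) Y p (T1 (T0 A) (T0 X) (T1 A X x))
        = Comp E (T0 (T0 A)) (T0 (T0 X)) Y q (T1 (T0 A) (T0 X) (T1 A X x))"
  shows "p = q"
proof (rule T_jointly_epi[OF _ Y p q])
  define Q where "Q = mk_functor (op_cat (full_subcat E S)) (\<lambda>B. Hom E (T0 B) Y)
    (\<lambda>A B g. \<lambda>f\<in>Hom E (T0 A) Y. Comp E (T0 B) (T0 A) Y f (T1 B A g))"
  have Q: "Q \<in> Obj (presheaf_cat (full_subcat E S))"
    unfolding Q_def
  proof (rule mk_presheaf)
    show "category (full_subcat E S)"
      by (rule category_full_subcat[OF category_axioms S_sub])
  qed (use locally_small Y in \<open>auto simp: locally_small_def T.farr_Comp Comp_assoc\<close>)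
  have fam: "nerve_family E S (T0 X) Q (\<lambda>B y. Comp E (T0 B) (T0 (T0 X)) Y h (T1 B (T0 X) y))"
    if "h \<in> Hom E (T0 (T0 X)) Y" for h
    unfolding nerve_family_def using that X Y
    by (simp add: Q_def T.farr_Comp Comp_assoc)
  fix B w assume B: "B \<in> S" "w \<in> Hom E B (T0 X)"
  show "Comp E (T0 B) (T0 (T0 X)) Y p (T1 B (T0 X) w) = Comp E (T0 B) (T0 (T0 X)) Y q (T1 B (T0 X) w)"
  proof (rule arities_unique[OF X Q fam[OF p] fam[OF q] _ B])
    fix A x B y assume "A \<in> S" "x \<in> Hom E A X" "B \<in> S" "y \<in> Hom E B (T0 A)"
    then show "Comp E (T0 B) (T0 (T0 X)) Y p (T1 B (T0 X) (Comp E B (T0 A) (T0 X) (T1 A X x) y)) =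
        Comp E (T0 B) (T0 (T0 X)) Y q (T1 B (T0 X) (Comp E B (T0 A) (T0 X) (T1 A X x) y))"
      using X Y p q eq by (simp add: T.farr_Comp flip: Comp_assoc)
  qed
qed (use X in simp)

end

section \<open>Algebras and the free-forgetful adjunction\<close>

context monad_on_category
begin

abbreviation EM where "EM \<equiv> em_cat E T"

text \<open>The free algebra on \<open>A\<close>.\<close>

abbreviation F where "F A \<equiv> (T0 A, \<mu> A)"

lemma em_Obj: "(X, a) \<in> Obj EM \<longleftrightarrow> X \<in> Obj E \<and> a \<in> Hom E (T0 X) X \<and>
    Comp E X (T0 X) X a (\<eta> X) = Ident E X \<and>
    Comp E (T0 (T0 X)) (T0 X) X a (\<mu> X) = Comp E (T0 (T0 X)) (T0 X) X a (T1 (T0 X) X a)"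
  by (simp add: em_cat_def em_algebra_def Let_def)

lemma em_Hom: "h \<in> Hom EM (X, a) (Y, b) \<longleftrightarrow> h \<in> Hom E X Y \<and>
    Comp E (T0 X) X Y h a = Comp E (T0 X) (T0 Y) Y b (T1 X Y h)"
  by (simp add: em_cat_def em_hom_def)

lemma em_Ident [simp]: "Ident EM (X, a) = Ident E X"
  by (simp add: em_cat_def)

lemma em_Comp [simp]: "Comp EM (X, a) (Y, b) (Z, c) g f = Comp E X Y Z g f"
  by (simp add: em_cat_def)

lemma category_em_cat: "category EM"
proof
  fix x y z f g
  assume *: "x \<in> Obj EM" "y \<in> Obj EM" "z \<in> Obj EM" "f \<in> Hom EM x y" "g \<in> Hom EM y z"
  obtain X a Y b Z c where "x = (X, a)" "y = (Y, b)" "z = (Z, c)" by (cases x, cases y, cases z)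
  with * show "Comp EM x y z g f \<in> Hom EM x z"
    by (simp add: em_Obj em_Hom Comp_assoc T.farr_Comp) (simp flip: Comp_assoc)
qed (auto simp: em_Obj em_Hom Comp_assoc)

lemma locally_small_em_cat:
  assumes "locally_small E"
  shows "locally_small EM"
proof -
  have "Hom EM x y \<prec> (UNIV :: 'u set)" if "x \<in> Obj EM" "y \<in> Obj EM" for x y
  proof -
    obtain X a Y b where xy: "x = (X, a)" "y = (Y, b)" by (cases x, cases y)
    have "Hom EM x y \<lesssim> Hom E X Y"
      unfolding xy by (rule subset_imp_lepoll) (auto simp: em_Hom)
    also have "Hom E X Y \<prec> (UNIV :: 'u set)"
      using assms that by (simp add: locally_small_def xy em_Obj)
    finally show ?thesis .
  qed
  with category_em_cat show ?thesis by (simp add: locally_small_def)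
qed

lemma free_in [simp]: "A \<in> Obj E \<Longrightarrow> F A \<in> Obj EM"
  by (simp add: em_Obj munit_left mmult_assoc)

lemma T1_em_Hom: "\<lbrakk>A \<in> Obj E; B \<in> Obj E; f \<in> Hom E A B\<rbrakk> \<Longrightarrow> T1 A B f \<in> Hom EM (F A) (F B)"
  by (simp add: em_Hom mu_nat)

text \<open>The extension of \<open>x : A \<rightarrow> X\<close> to a homomorphism from the free algebra on \<open>A\<close> to \<open>(X, a)\<close>. The
  definition makes sense for any \<open>a : T X \<rightarrow> X\<close>.\<close>

definition free_ext where "free_ext X a A x = Comp E (T0 A) (T0 X) X a (T1 A X x)"

lemma free_ext_in:
  assumes X: "(X, a) \<in> Obj EM" and A: "A \<in> Obj E" "x \<in> Hom E A X"
  shows "free_ext X a A x \<in> Hom EM (F A) (X, a)"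
proof -
  have X': "X \<in> Obj E" "a \<in> Hom E (T0 X) X"
    and assoc: "Comp E (T0 (T0 X)) (T0 X) X a (\<mu> X) = Comp E (T0 (T0 X)) (T0 X) X a (T1 (T0 X) X a)"
    using X by (simp_all add: em_Obj)
  have "Comp E (T0 (T0 A)) (T0 A) X (free_ext X a A x) (\<mu> A) =
      Comp E (T0 (T0 A)) (T0 X) X a (Comp E (T0 (T0 A)) (T0 A) (T0 X) (T1 A X x) (\<mu> A))"
    unfolding free_ext_def using X' A by (simp add: Comp_assoc)
  also have "\<dots> = Comp E (T0 (T0 A)) (T0 X) X a
      (Comp E (T0 (T0 A)) (T0 (T0 X)) (T0 X) (\<mu> X) (T1 (T0 A) (T0 X) (T1 A X x)))"
    using X' A by (simp add: mu_nat)
  also have "\<dots> = Comp E (T0 (T0 A)) (T0 X) X a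
      (Comp E (T0 (T0 A)) (T0 (T0 X)) (T0 X) (T1 (T0 X) X a) (T1 (T0 A) (T0 X) (T1 A X x)))"
    by (rule Comp_eq_precomp[OF assoc]) (use X' A in simp_all)
  also have "\<dots> = Comp E (T0 (T0 A)) (T0 X) X a (T1 (T0 A) X (free_ext X a A x))"
    unfolding free_ext_def using X' A by (simp add: T.farr_Comp)
  finally show ?thesis
    using X' A by (simp add: em_Hom free_ext_def)
qed

lemma free_ext_in_Hom [simp]:
  "\<lbrakk>X \<in> Obj E; a \<in> Hom E (T0 X) X; A \<in> Obj E; x \<in> Hom E A X\<rbrakk> \<Longrightarrow> free_ext X a A x \<in> Hom E (T0 A) X"
  by (simp add: free_ext_def)

lemma free_ext_eta:
  assumes "(X, a) \<in> Obj EM" and "A \<in> Obj E" "x \<in> Hom E A X"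
  shows "Comp E A (T0 A) X (free_ext X a A x) (\<eta> A) = x"
proof -
  have X': "X \<in> Obj E" "a \<in> Hom E (T0 X) X" "Comp E X (T0 X) X a (\<eta> X) = Ident E X"
    using assms by (simp_all add: em_Obj)
  have "Comp E A (T0 A) X (free_ext X a A x) (\<eta> A) = Comp E A (T0 X) X a (Comp E A X (T0 X) (\<eta> X) x)"
    unfolding free_ext_def using X' assms by (simp add: Comp_assoc eta_nat)
  also have "\<dots> = Comp E A X X (Comp E X (T0 X) X a (\<eta> X)) x"
    by (rule Comp_assoc[symmetric]) (use X' assms in simp_all)
  finally show ?thesis using X' assms by simp
qed

lemma free_ext_T1:
  "\<lbrakk>X \<in> Obj E; a \<in> Hom E (T0 X) X; A \<in> Obj E; B \<in> Obj E; x \<in> Hom E A X; u \<in> Hom E B A\<rbrakk>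
    \<Longrightarrow> free_ext X a B (Comp E B A X x u) = Comp E (T0 B) (T0 A) X (free_ext X a A x) (T1 B A u)"
  by (simp add: free_ext_def T.farr_Comp Comp_assoc)

lemma free_ext_postcomp:
  assumes X: "(X, a) \<in> Obj EM" and Y: "(Y, b) \<in> Obj EM" and h: "h \<in> Hom EM (X, a) (Y, b)"
    and A: "A \<in> Obj E" "x \<in> Hom E A X"
  shows "free_ext Y b A (Comp E A X Y h x) = Comp E (T0 A) X Y h (free_ext X a A x)"
proof -
  have *: "X \<in> Obj E" "a \<in> Hom E (T0 X) X" "Y \<in> Obj E" "b \<in> Hom E (T0 Y) Y" "h \<in> Hom E X Y"
    "Comp E (T0 X) X Y h a = Comp E (T0 X) (T0 Y) Y b (T1 X Y h)"
    using X Y h by (simp_all add: em_Obj em_Hom)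
  have "Comp E (T0 A) X Y h (Comp E (T0 A) (T0 X) X a (T1 A X x)) =
      Comp E (T0 A) (T0 Y) Y b (Comp E (T0 A) (T0 X) (T0 Y) (T1 X Y h) (T1 A X x))"
    by (rule Comp_eq_precomp[OF *(6)]) (use * A in simp_all)
  then show ?thesis
    unfolding free_ext_def using * A by (simp add: T.farr_Comp)
qed

lemma free_ext_free_unit: "A \<in> Obj E \<Longrightarrow> free_ext (T0 A) (\<mu> A) A (\<eta> A) = Ident E (T0 A)"
  by (simp add: free_ext_def munit_right)

lemma free_ext_of_eta:
  assumes X: "(X, a) \<in> Obj EM" and A: "A \<in> Obj E" and f: "f \<in> Hom EM (F A) (X, a)"
  shows "free_ext X a A (Comp E A (T0 A) X f (\<eta> A)) = f"
proof -
  have "free_ext X a A (Comp E A (T0 A) X f (\<eta> A)) =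
      Comp E (T0 A) (T0 A) X f (free_ext (T0 A) (\<mu> A) A (\<eta> A))"
    by (rule free_ext_postcomp[OF _ X f A]) (use A in simp_all)
  then show ?thesis
    using A X f by (simp add: free_ext_free_unit em_Obj em_Hom)
qed

lemma free_ext_free_eta:
  assumes "A \<in> Obj E" "B \<in> Obj E" "u \<in> Hom E B A"
  shows "free_ext (T0 A) (\<mu> A) B (Comp E B A (T0 A) (\<eta> A) u) = T1 B A u"
  using assms by (simp add: free_ext_T1 free_ext_free_unit)

lemma free_ext_bij:
  assumes X: "(X, a) \<in> Obj EM" and A: "A \<in> Obj E"
  shows "bij_betw (free_ext X a A) (Hom E A X) (Hom EM (F A) (X, a))"
  by (rule bij_betw_byWitness[where f' = "\<lambda>f. Comp E A (T0 A) X f (\<eta> A)"])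
    (use assms free_ext_in free_ext_eta free_ext_of_eta in \<open>auto simp: em_Hom em_Obj\<close>)

end

section \<open>Density of the free algebras\<close>

context arities_monad
begin

abbreviation \<Theta> where "\<Theta> \<equiv> Theta_objs E S T"

lemma Theta_objs_eq: "\<Theta> = F ` S"
  unfolding Theta_objs_def free_algebra_def by (rule image_cong) simp_all

lemma Theta_I [simp]: "A \<in> S \<Longrightarrow> F A \<in> \<Theta>"
  by (simp add: Theta_objs_eq)

lemma Theta_sub: "\<Theta> \<subseteq> Obj EM"
  by (auto simp: Theta_objs_eq simp del: prod.inject)

text \<open>A natural family \<open>\<phi>\<close> from the nerve of \<open>(X, a)\<close> to that of \<open>(Y, b)\<close> restricts to one from the
  nerve of \<open>X\<close> to that of \<open>Y\<close>, which is represented by some \<open>h : X \<rightarrow> Y\<close>. Naturality of \<open>\<phi>\<close> with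
  respect to all homomorphisms between free algebras gives \<open>h \<circ> a \<circ> T u = \<phi> (a \<circ> T u) = b \<circ> T h \<circ> T u\<close>
  for \<open>u : A \<rightarrow> X\<close>, and since such \<open>T u\<close> are jointly epic, \<open>h\<close> is a homomorphism.\<close>

lemma dense_Theta: "dense_generator EM \<Theta>"
proof -
  have ls: "locally_small EM"
    by (rule locally_small_em_cat[OF locally_small])
  have "\<Theta> \<lesssim> S"
    unfolding Theta_objs_eq by (rule image_lepoll)
  also have "S \<prec> (UNIV :: 'u set)"
    using dense by (simp add: dense_generator_def small_category_def)
  finally have "small_category (full_subcat EM \<Theta>)"
    using ls Theta_sub category_full_subcat[OF category_em_cat Theta_sub]
    by (auto simp: small_category_def locally_small_def)
  moreover have "fully_faithful EM (presheaf_cat (full_subcat EM \<Theta>)) (nerve EM \<Theta>)"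
    unfolding nerve_fully_faithful_iff[OF ls Theta_sub]
  proof (intro ballI conjI impI allI)
    fix x y h k
    assume xy: "x \<in> Obj EM" "y \<in> Obj EM" "h \<in> Hom EM x y" "k \<in> Hom EM x y"
      and eq: "\<forall>A\<in>\<Theta>. \<forall>f\<in>Hom EM A x. Comp EM A x y h f = Comp EM A x y k f"
    obtain X a Y b where [simp]: "x = (X, a)" "y = (Y, b)" by (cases x, cases y)
    have *: "X \<in> Obj E" "a \<in> Hom E (T0 X) X" "Y \<in> Obj E" "h \<in> Hom E X Y" "k \<in> Hom E X Y"
      using xy by (simp_all add: em_Obj em_Hom)
    show "h = k"
    proof (rule dense_eq[OF *(1,3-5)])
      fix A f assume A: "A \<in> S" "f \<in> Hom E A X"
      let ?t = "free_ext X a A f"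
      have "Comp E (T0 A) X Y h ?t = Comp E (T0 A) X Y k ?t"
        using eq[rule_format, OF Theta_I[OF A(1)], of ?t] free_ext_in[of X a A f] xy A by simp
      then have "Comp E A X Y h (Comp E A (T0 A) X ?t (\<eta> A)) = Comp E A X Y k (Comp E A (T0 A) X ?t (\<eta> A))"
        by (rule Comp_eq_precomp) (use * A in simp_all)
      then show "Comp E A X Y h f = Comp E A X Y k f"
        using free_ext_eta[of X a A f] xy A by simp
    qed
  next
    fix x y \<phi>
    assume xy: "x \<in> Obj EM" "y \<in> Obj EM" and \<phi>: "nerve_family EM \<Theta> x (nerve_presheaf EM \<Theta> y) \<phi>"
    obtain X a Y b where [simp]: "x = (X, a)" "y = (Y, b)" by (cases x, cases y)
    have *: "X \<in> Obj E" "a \<in> Hom E (T0 X) X" "Y \<in> Obj E" "b \<in> Hom E (T0 Y) Y"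
      and X: "(X, a) \<in> Obj EM" and Y: "(Y, b) \<in> Obj EM"
      using xy by (simp_all add: em_Obj)
    have \<phi>_in: "\<phi> (F A) f \<in> Hom EM (F A) (Y, b)" if "A \<in> S" "f \<in> Hom EM (F A) (X, a)" for A f
      using nerve_familyD(1)[OF \<phi>, of "F A" f] that by simp
    have \<phi>_nat: "\<phi> (F B) (Comp E (T0 B) (T0 A) X f g) = Comp E (T0 B) (T0 A) Y (\<phi> (F A) f) g"
      if "A \<in> S" "B \<in> S" "f \<in> Hom EM (F A) (X, a)" "g \<in> Hom EM (F B) (F A)" for A B f g
      using nerve_familyD(2)[OF \<phi>, of "F A" "F B" f g] that \<phi>_in by simp
    have \<phi>_Hom [simp]: "\<phi> (F A) (free_ext X a A u) \<in> Hom E (T0 A) Y" if "A \<in> S" "u \<in> Hom E A X" for A u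
      using \<phi>_in[OF that(1) free_ext_in[OF X _ that(2)]] that by (simp add: em_Hom)
    define \<psi> where "\<psi> A u = Comp E A (T0 A) Y (\<phi> (F A) (free_ext X a A u)) (\<eta> A)" for A u
    have "nerve_family E S X (nerve_presheaf E S Y) \<psi>"
      unfolding nerve_family_def
    proof (intro conjI ballI)
      fix A f assume "A \<in> S" "f \<in> Hom E A X"
      then show "\<psi> A f \<in> fobj (nerve_presheaf E S Y) A"
        using * by (simp add: \<psi>_def)
    next
      fix A B f g assume h: "A \<in> S" "B \<in> S" "f \<in> Hom E A X" "g \<in> Hom E B A"
      have "\<psi> B (Comp E B A X f g) = Comp E B (T0 B) Y
          (Comp E (T0 B) (T0 A) Y (\<phi> (F A) (free_ext X a A f)) (T1 B A g)) (\<eta> B)"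
        unfolding \<psi>_def using * h by (simp add: free_ext_T1 \<phi>_nat free_ext_in[OF X] T1_em_Hom)
      also have "\<dots> = Comp E B A Y (\<psi> A f) g"
        unfolding \<psi>_def using * h by (simp add: Comp_assoc eta_nat)
      finally show "\<psi> B (Comp E B A X f g) = farr (nerve_presheaf E S Y) A B g (\<psi> A f)"
        using * h by (simp add: \<psi>_def)
    qed
    then obtain h where h: "h \<in> Hom E X Y"
      and \<psi>h: "\<And>A u. \<lbrakk>A \<in> S; u \<in> Hom E A X\<rbrakk> \<Longrightarrow> \<psi> A u = Comp E A X Y h u"
      using dense_represented[OF *(1,3)] by metis
    have \<phi>h: "\<phi> (F A) (free_ext X a A u) = Comp E (T0 A) X Y h (free_ext X a A u)"
      if A: "A \<in> S" "u \<in> Hom E A X" for A u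
    proof (rule dense_eq)
      let ?t = "free_ext X a A u"
      fix B v assume B: "B \<in> S" "v \<in> Hom E B (T0 A)"
      let ?v = "free_ext (T0 A) (\<mu> A) B v"
      have t: "?t \<in> Hom EM (F A) (X, a)" and v: "?v \<in> Hom EM (F B) (F A)"
        using free_ext_in X A B by simp_all
      have "Comp E B X Y h (Comp E B (T0 A) X ?t v) = \<psi> B (Comp E B (T0 A) X ?t v)"
        by (rule \<psi>h[symmetric]) (use * A B in simp_all)
      also have "\<dots> = Comp E B (T0 B) Y (\<phi> (F B) (Comp E (T0 B) (T0 A) X ?t ?v)) (\<eta> B)"
        unfolding \<psi>_def using free_ext_postcomp[OF _ X t, of B v] A B by simp
      also have "\<dots> = Comp E B (T0 A) Y (\<phi> (F A) ?t) (Comp E B (T0 B) (T0 A) ?v (\<eta> B))"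
        using * A B \<phi>_nat[OF A(1) B(1) t v] by (simp add: Comp_assoc)
      also have "\<dots> = Comp E B (T0 A) Y (\<phi> (F A) ?t) v"
        using free_ext_eta[OF free_in, of A B v] A B by simp
      finally show "Comp E B (T0 A) Y (\<phi> (F A) ?t) v = Comp E B (T0 A) Y (Comp E (T0 A) X Y h ?t) v"
        using * A B h by (simp add: Comp_assoc)
    qed (use * A h in simp_all)
    have "h \<in> Hom EM (X, a) (Y, b)"
    proof -
      have "Comp E (T0 X) X Y h a = Comp E (T0 X) (T0 Y) Y b (T1 X Y h)"
      proof (rule T_jointly_epi)
        fix A u assume A: "A \<in> S" "u \<in> Hom E A X"
        let ?t = "free_ext X a A u"
        have "Comp E (T0 A) X Y h ?t = free_ext Y b A (\<psi> A u)"
          using free_ext_of_eta[OF Y _ \<phi>_in[OF A(1) free_ext_in[OF X _ A(2)]]] A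
          by (simp add: \<psi>_def \<phi>h)
        also have "\<dots> = free_ext Y b A (Comp E A X Y h u)"
          using \<psi>h A by simp
        finally show "Comp E (T0 A) (T0 X) Y (Comp E (T0 X) X Y h a) (T1 A X u) =
            Comp E (T0 A) (T0 X) Y (Comp E (T0 X) (T0 Y) Y b (T1 X Y h)) (T1 A X u)"
          using * A h by (simp add: free_ext_def Comp_assoc T.farr_Comp)
      qed (use * h in simp_all)
      then show ?thesis using h by (simp add: em_Hom)
    qed
    moreover have "\<phi> \<theta> f = Comp EM \<theta> (X, a) (Y, b) h f" if \<theta>: "\<theta> \<in> \<Theta>" "f \<in> Hom EM \<theta> (X, a)" for \<theta> f
    proof -
      obtain A where A: "A \<in> S" "\<theta> = F A" using \<theta> by (auto simp: Theta_objs_eq)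
      let ?u = "Comp E A (T0 A) X f (\<eta> A)"
      have "?u \<in> Hom E A X" "free_ext X a A ?u = f"
        using A \<theta> * free_ext_of_eta[OF X] by (simp_all add: em_Hom)
      with \<phi>h[OF A(1), of ?u] show ?thesis by (simp add: A)
    qed
    ultimately show "\<exists>h\<in>Hom EM x y. \<forall>A\<in>\<Theta>. \<forall>f\<in>Hom EM A x. \<phi> A f = Comp EM A x y h f"
      by auto
  qed
  ultimately show ?thesis
    using ls Theta_sub by (simp add: dense_generator_def)
qed

end

section \<open>The essential image of the nerve of algebras\<close>

context arities_monad
begin

lemma Theta_eq: "Theta E S T = full_subcat EM \<Theta>"
  by (simp add: Theta_def)

lemmas locally_small_EM = locally_small_em_cat[OF locally_small]

lemmas nerve_EM_in = nerve_presheaf_in[OF locally_small_EM Theta_sub]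

lemma theory_functor_simps:
  "A \<in> S \<Longrightarrow> fobj (theory_functor E S T) A = F A"
  "\<lbrakk>A \<in> S; B \<in> S; u \<in> Hom E B A\<rbrakk> \<Longrightarrow> farr (theory_functor E S T) B A u = T1 B A u"
  by (simp_all add: theory_functor_def comp_functor_def inclusion_def free_algebra_def)

text \<open>Restriction along the functor from \<open>S\<close> to \<open>\<Theta>\<close>.\<close>

abbreviation res where "res \<equiv> restrict_presheaf (full_subcat E S) (theory_functor E S T)"

lemma res_simps [simp]:
  "A \<in> S \<Longrightarrow> fobj (res P) A = fobj P (F A)"
  "\<lbrakk>A \<in> S; B \<in> S; u \<in> Hom E B A\<rbrakk> \<Longrightarrow> farr (res P) A B u = farr P (F A) (F B) (T1 B A u)"
  by (simp_all add: restrict_presheaf_def comp_functor_def op_functor_def theory_functor_simps)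

context
  fixes P assumes P: "P \<in> Obj (presheaf_cat (full_subcat EM \<Theta>))"
begin

lemmas P_small = presheaf_small[OF P, simplified]
lemmas P_funcset = presheaf_funcset[OF P, simplified]
lemmas P_in = presheaf_in[OF P, simplified]
lemmas P_Ident = presheaf_Ident[OF P, simplified]
lemmas P_Comp = presheaf_Comp[OF P, simplified]

lemma res_in: "res P \<in> Obj (presheaf_cat (full_subcat E S))"
  unfolding restrict_presheaf_def comp_functor_def
proof (rule mk_presheaf, goal_cases)
  case 1
  show ?case by (rule category_full_subcat[OF category_axioms S_sub])
next
  case (4 A e)
  then show ?case
    using P_Ident[of "F A" e] by (simp add: op_functor_def theory_functor_simps)
next
  case (5 A B C u v e)
  then show ?case
    using P_Comp[of "F A" "F B" "F C" "T1 B A u" "T1 C B v" e] T1_em_Hom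
    by (simp add: op_functor_def theory_functor_simps T.farr_Comp)
qed (use P_small P_funcset T1_em_Hom in \<open>simp_all add: op_functor_def theory_functor_simps\<close>)

text \<open>If \<open>P\<close> is isomorphic to the nerve of an algebra, then its restriction is isomorphic to the nerve
  of the underlying object, by the bijection between homomorphisms from \<open>F A\<close> and arrows from \<open>A\<close>.\<close>

lemma restriction_represented:
  assumes X: "(X, a) \<in> Obj EM"
    and iso: "isomorphic (presheaf_cat (full_subcat EM \<Theta>)) P (nerve_presheaf EM \<Theta> (X, a))"
  shows "isomorphic (presheaf_cat (full_subcat E S)) (res P) (nerve_presheaf E S X)"
proof -
  have X': "X \<in> Obj E" using X by (simp add: em_Obj)
  from iso obtain \<tau>
    where \<tau>: "\<tau> \<in> Hom (presheaf_cat (full_subcat EM \<Theta>)) P (nerve_presheaf EM \<Theta> (X, a))"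
    and bij: "\<And>\<theta>. \<theta> \<in> \<Theta> \<Longrightarrow> bij_betw (\<tau> \<theta>) (fobj P \<theta>) (Hom EM \<theta> (X, a))"
    unfolding presheaf_isomorphic_iff[OF P nerve_EM_in[OF X]] by auto
  have \<tau>_in: "\<tau> (F A) e \<in> Hom EM (F A) (X, a)" if "A \<in> S" "e \<in> fobj P (F A)" for A e
    using bij_betwE[OF bij[OF Theta_I]] that by blast
  then have \<tau>_in' [simp]: "\<tau> (F A) e \<in> Hom E (T0 A) X" if "A \<in> S" "e \<in> fobj P (F A)" for A e
    using that by (simp add: em_Hom)
  have \<tau>_nat: "\<tau> (F B) (farr P (F A) (F B) (T1 B A u) e) = Comp E (T0 B) (T0 A) X (\<tau> (F A) e) (T1 B A u)"
    if "A \<in> S" "B \<in> S" "u \<in> Hom E B A" "e \<in> fobj P (F A)" for A B u e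
    using \<tau>[unfolded presheaf_hom_iff[OF P nerve_EM_in[OF X]]] that T1_em_Hom \<tau>_in by simp
  define \<sigma> where "\<sigma> A e = Comp E A (T0 A) X (\<tau> (F A) e) (\<eta> A)" for A e
  define \<sigma>' where "\<sigma>' = (\<lambda>A\<in>Obj (full_subcat E S). \<lambda>e\<in>fobj (res P) A. \<sigma> A e)"
  have "\<sigma>' \<in> Hom (presheaf_cat (full_subcat E S)) (res P) (nerve_presheaf E S X)"
    unfolding \<sigma>'_def
  proof (rule presheaf_homI[OF res_in nerve_in[OF X']])
    fix A e assume "A \<in> Obj (full_subcat E S)" "e \<in> fobj (res P) A"
    then show "\<sigma> A e \<in> fobj (nerve_presheaf E S X) A"
      using X' by (simp add: \<sigma>_def)
  next
    fix A B u e assume "A \<in> Obj (full_subcat E S)" "B \<in> Obj (full_subcat E S)"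
      "u \<in> Hom (full_subcat E S) B A" "e \<in> fobj (res P) A"
    then show "\<sigma> B (farr (res P) A B u e) = farr (nerve_presheaf E S X) A B u (\<sigma> A e)"
      using X' by (simp add: \<sigma>_def \<tau>_nat Comp_assoc eta_nat)
  qed
  moreover have "bij_betw (\<sigma>' A) (fobj (res P) A) (fobj (nerve_presheaf E S X) A)" if A: "A \<in> S" for A
  proof -
    have "bij_betw (\<lambda>f. Comp E A (T0 A) X f (\<eta> A)) (Hom EM (F A) (X, a)) (Hom E A X)"
      by (rule bij_betw_byWitness[where f' = "free_ext X a A"])
        (use A X X' free_ext_in free_ext_eta free_ext_of_eta in \<open>auto simp: em_Hom\<close>)
    from bij_betw_trans[OF bij[OF Theta_I[OF A]] this]
    have "bij_betw (\<sigma> A) (fobj P (F A)) (Hom E A X)"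
      by (simp add: \<sigma>_def[abs_def] comp_def)
    moreover have "bij_betw (\<sigma>' A) (fobj P (F A)) (Hom E A X) \<longleftrightarrow> bij_betw (\<sigma> A) (fobj P (F A)) (Hom E A X)"
      by (rule bij_betw_cong) (use A in \<open>simp add: \<sigma>'_def\<close>)
    ultimately show ?thesis using A by simp
  qed
  ultimately show ?thesis
    unfolding presheaf_isomorphic_iff[OF res_in nerve_in[OF X']] by auto
qed

text \<open>Conversely, let \<open>\<beta>\<close> be an isomorphism from the restriction of \<open>P\<close> to the nerve of \<open>X\<close>. An
  element \<open>e\<close> of \<open>P (F A)\<close> stands for an arrow \<open>\<beta> A e : A \<rightarrow> X\<close>, and should also be a homomorphism
  from \<open>F A\<close> to the algebra to be found. The arrows \<open>y : B \<rightarrow> T A\<close> act on \<open>e\<close> since they correspond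
  to the homomorphisms from \<open>F B\<close> to \<open>F A\<close>. The structure map \<open>a\<close> is the one which turns this action
  into composition: \<open>a \<circ> T (\<beta> A e) \<circ> y\<close> is \<open>\<beta> B\<close> of the action of \<open>y\<close> on \<open>e\<close>. It exists by the
  universal property of the nerve of \<open>T X\<close> and the density of \<open>S\<close>. The unit law of algebras holds
  since \<open>\<eta>\<close> acts as the identity, the associativity law since the action is compatible with
  composition.\<close>

lemma restriction_representedD:
  assumes X: "X \<in> Obj E"
    and iso: "isomorphic (presheaf_cat (full_subcat E S)) (res P) (nerve_presheaf E S X)"
  obtains a where "(X, a) \<in> Obj EM"
    "isomorphic (presheaf_cat (full_subcat EM \<Theta>)) P (nerve_presheaf EM \<Theta> (X, a))"
proof -
  from iso obtain \<beta>
    where \<beta>: "\<beta> \<in> Hom (presheaf_cat (full_subcat E S)) (res P) (nerve_presheaf E S X)"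
    and "\<forall>A\<in>S. bij_betw (\<beta> A) (fobj (res P) A) (fobj (nerve_presheaf E S X) A)"
    unfolding presheaf_isomorphic_iff[OF res_in nerve_in[OF X]] by auto
  then have bij: "bij_betw (\<beta> A) (fobj P (F A)) (Hom E A X)" if "A \<in> S" for A
    using that by simp
  have \<beta>_in [simp]: "\<beta> A e \<in> Hom E A X" if "A \<in> S" "e \<in> fobj P (F A)" for A e
    using bij_betwE[OF bij] that by blast
  define \<alpha> where "\<alpha> A = inv_into (fobj P (F A)) (\<beta> A)" for A
  have \<alpha>_in [simp]: "\<alpha> A x \<in> fobj P (F A)" and \<beta>\<alpha> [simp]: "\<beta> A (\<alpha> A x) = x"
    if "A \<in> S" "x \<in> Hom E A X" for A x
    unfolding \<alpha>_def using bij[OF that(1)] that(2)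
    by (auto simp: bij_betw_def inv_into_into f_inv_into_f)
  have \<alpha>\<beta>: "\<alpha> A (\<beta> A e) = e" if "A \<in> S" "e \<in> fobj P (F A)" for A e
    unfolding \<alpha>_def using bij[OF that(1)] that(2) by (rule bij_betw_inv_into_left)
  \<comment> \<open>The homomorphism from \<open>F B\<close> to \<open>F A\<close> that extends \<open>y : B \<rightarrow> T A\<close>.\<close>
  let ?hat = "\<lambda>A B y. free_ext (T0 A) (\<mu> A) B y"
  define act where "act A B y e = farr P (F A) (F B) (?hat A B y) e" for A B y e
  have hat: "?hat A B y \<in> Hom EM (F B) (F A)" if "A \<in> S" "B \<in> S" "y \<in> Hom E B (T0 A)" for A B y
    using that free_ext_in by simp
  have act_in [simp]: "act A B y e \<in> fobj P (F B)"
    if "A \<in> S" "B \<in> S" "y \<in> Hom E B (T0 A)" "e \<in> fobj P (F A)" for A B y e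
    unfolding act_def using that hat P_in by simp
  have act_eta: "act A A (\<eta> A) e = e" if "A \<in> S" "e \<in> fobj P (F A)" for A e
    unfolding act_def using that P_Ident[of "F A" e] by (simp add: free_ext_free_unit)
  have act_act: "act B C z (act A B y e) = act A C (Comp E C (T0 B) (T0 A) (?hat A B y) z) e"
    if "A \<in> S" "B \<in> S" "C \<in> S" "y \<in> Hom E B (T0 A)" "z \<in> Hom E C (T0 B)" "e \<in> fobj P (F A)"
    for A B C y z e
    unfolding act_def
    using that P_Comp[of "F A" "F B" "F C" "?hat A B y" "?hat B C z" e] hat
      free_ext_postcomp[OF _ _ hat[OF that(1,2,4)], of C z] by simp
  have \<beta>_nat: "\<beta> B (act A B (Comp E B A (T0 A) (\<eta> A) u) e) = Comp E B A X (\<beta> A e) u"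
    if "A \<in> S" "B \<in> S" "u \<in> Hom E B A" "e \<in> fobj P (F A)" for A B u e
    using \<beta>[unfolded presheaf_hom_iff[OF res_in nerve_in[OF X]]] that
    by (simp add: act_def free_ext_free_eta)
  have \<beta>_precomp: "\<beta> C (act A C (Comp E C B (T0 A) y g) e) = Comp E C B X (\<beta> B (act A B y e)) g"
    if "A \<in> S" "B \<in> S" "C \<in> S" "y \<in> Hom E B (T0 A)" "g \<in> Hom E C B" "e \<in> fobj P (F A)" for A B C y g e
  proof -
    have "act B C (Comp E C B (T0 B) (\<eta> B) g) (act A B y e) = act A C (Comp E C B (T0 A) y g) e"
      using that free_ext_eta[of "T0 A" "\<mu> A" B y] by (simp add: act_act flip: Comp_assoc)
    with \<beta>_nat[of B C g "act A B y e"] that show ?thesis by simp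
  qed
  have fam: "nerve_family E S (T0 A) (nerve_presheaf E S X) (\<lambda>B y. \<beta> B (act A B y (\<alpha> A x)))"
    if "A \<in> S" "x \<in> Hom E A X" for A x
    unfolding nerve_family_def using that X by (simp add: \<beta>_precomp)
  have compat: "\<beta> B (act A' B y (\<alpha> A' (Comp E A' A X x u))) =
      \<beta> B (act A B (Comp E B (T0 A') (T0 A) (T1 A' A u) y) (\<alpha> A x))"
    if h: "A \<in> S" "A' \<in> S" "x \<in> Hom E A X" "u \<in> Hom E A' A" "B \<in> S" "y \<in> Hom E B (T0 A')"
    for A A' x u B y
  proof -
    have "\<alpha> A' (Comp E A' A X x u) = act A A' (Comp E A' A (T0 A) (\<eta> A) u) (\<alpha> A x)"
      using \<alpha>\<beta>[of A' "act A A' (Comp E A' A (T0 A) (\<eta> A) u) (\<alpha> A x)"] h X by (simp add: \<beta>_nat)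
    then show ?thesis
      using h by (simp add: act_act free_ext_free_eta)
  qed
  obtain \<phi> where \<phi>: "nerve_family E S (T0 X) (nerve_presheaf E S X) \<phi>"
    and \<phi>_eq: "\<And>A x B y. \<lbrakk>A \<in> S; x \<in> Hom E A X; B \<in> S; y \<in> Hom E B (T0 A)\<rbrakk>
      \<Longrightarrow> \<phi> B (Comp E B (T0 A) (T0 X) (T1 A X x) y) = \<beta> B (act A B y (\<alpha> A x))"
    using arities_exists[of X "nerve_presheaf E S X" "\<lambda>A x B y. \<beta> B (act A B y (\<alpha> A x))",
        OF X nerve_in[OF X] fam compat] by blast
  obtain a where a [simp]: "a \<in> Hom E (T0 X) X"
    and \<phi>a: "\<And>B w. \<lbrakk>B \<in> S; w \<in> Hom E B (T0 X)\<rbrakk> \<Longrightarrow> \<phi> B w = Comp E B (T0 X) X a w"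
    using dense_represented[OF _ X \<phi>] X by auto
  have a_eq: "Comp E B (T0 X) X a (Comp E B (T0 A) (T0 X) (T1 A X (\<beta> A e)) y) = \<beta> B (act A B y e)"
    if "A \<in> S" "e \<in> fobj P (F A)" "B \<in> S" "y \<in> Hom E B (T0 A)" for A e B y
    using \<phi>_eq[of A "\<beta> A e" B y] that X by (simp add: \<phi>a \<alpha>\<beta>)
  have unit: "Comp E X (T0 X) X a (\<eta> X) = Ident E X"
  proof (rule dense_eq)
    fix A x assume A: "A \<in> S" "x \<in> Hom E A X"
    have "Comp E A (T0 X) X a (Comp E A X (T0 X) (\<eta> X) x) = x"
      using a_eq[of A "\<alpha> A x" A "\<eta> A"] A X by (simp add: eta_nat act_eta)
    then show "Comp E A X X (Comp E X (T0 X) X a (\<eta> X)) x = Comp E A X X (Ident E X) x"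
      using A X by (simp add: Comp_assoc)
  qed (use X in simp_all)
  \<comment> \<open>The law is tested on \<open>T (T x) \<circ> T y \<circ> z\<close>, where both sides are \<open>\<beta> C\<close> of the
    result of letting first \<open>y\<close> and then \<open>z\<close> act on \<open>e\<close>.\<close>
  have assoc: "Comp E (T0 (T0 X)) (T0 X) X a (\<mu> X) = Comp E (T0 (T0 X)) (T0 X) X a (T1 (T0 X) X a)"
    (is "?l = ?r")
  proof (rule TT_jointly_epi)
    fix A x assume A: "A \<in> S" "x \<in> Hom E A X"
    define e where "e = \<alpha> A x"
    have e: "e \<in> fobj P (F A)" and x: "x = \<beta> A e" using A by (simp_all add: e_def)
    let ?TTx = "T1 (T0 A) (T0 X) (T1 A X x)"
    show "Comp E (T0 (T0 A)) (T0 (T0 X)) X ?l ?TTx = Comp E (T0 (T0 A)) (T0 (T0 X)) X ?r ?TTx"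
    proof (rule T_jointly_epi)
      fix B y assume B: "B \<in> S" "y \<in> Hom E B (T0 A)"
      let ?Ty = "T1 B (T0 A) y"
      have "Comp E (T0 B) (T0 X) X a (Comp E (T0 B) (T0 A) (T0 X) (T1 A X x) (?hat A B y)) =
          Comp E (T0 B) (T0 X) X a (T1 B X (\<beta> B (act A B y e)))"
      proof (rule dense_eq)
        fix C z assume C: "C \<in> S" "z \<in> Hom E C (T0 B)"
        have "Comp E C (T0 X) X a (Comp E C (T0 A) (T0 X) (T1 A X x) (Comp E C (T0 B) (T0 A) (?hat A B y) z)) =
            Comp E C (T0 X) X a (Comp E C (T0 B) (T0 X) (T1 B X (\<beta> B (act A B y e))) z)"
          using A B C e by (simp add: x a_eq act_act)
        then show "Comp E C (T0 B) X (Comp E (T0 B) (T0 X) X a (Comp E (T0 B) (T0 A) (T0 X) (T1 A X x) (?hat A B y))) z =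
            Comp E C (T0 B) X (Comp E (T0 B) (T0 X) X a (T1 B X (\<beta> B (act A B y e)))) z"
          using A B C e X by (simp add: Comp_assoc)
      qed (use A B e X in simp_all)
      also have "\<beta> B (act A B y e) = Comp E B (T0 X) X a (Comp E B (T0 A) (T0 X) (T1 A X x) y)"
        using A B e by (simp add: x a_eq)
      finally have eq: "Comp E (T0 B) (T0 X) X a (Comp E (T0 B) (T0 A) (T0 X) (T1 A X x) (?hat A B y)) =
          Comp E (T0 B) (T0 X) X a (T1 B X (Comp E B (T0 X) X a (Comp E B (T0 A) (T0 X) (T1 A X x) y)))" .
      have "Comp E (T0 B) (T0 (T0 X)) (T0 X) (\<mu> X) (Comp E (T0 B) (T0 (T0 A)) (T0 (T0 X)) ?TTx ?Ty) =
          Comp E (T0 B) (T0 A) (T0 X) (T1 A X x) (Comp E (T0 B) (T0 (T0 A)) (T0 A) (\<mu> A) ?Ty)"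
        by (rule Comp_eq_precomp[OF mu_nat]) (use A B X in simp_all)
      with eq show "Comp E (T0 B) (T0 (T0 A)) X (Comp E (T0 (T0 A)) (T0 (T0 X)) X ?l ?TTx) ?Ty =
          Comp E (T0 B) (T0 (T0 A)) X (Comp E (T0 (T0 A)) (T0 (T0 X)) X ?r ?TTx) ?Ty"
        using A B X by (simp add: free_ext_def Comp_assoc T.farr_Comp)
    qed (use A X in simp_all)
  qed (use X in simp_all)
  have alg: "(X, a) \<in> Obj EM"
    using X unit assoc by (simp add: em_Obj)
  \<comment> \<open>Different objects of \<open>S\<close> may have the same free algebra, so that a representative has to be
    chosen.\<close>
  define rep where "rep \<theta> = (SOME A. A \<in> S \<and> F A = \<theta>)" for \<theta>
  have rep: "rep \<theta> \<in> S" "F (rep \<theta>) = \<theta>" if "\<theta> \<in> \<Theta>" for \<theta>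
    using someI_ex[of "\<lambda>A. A \<in> S \<and> F A = \<theta>"] that by (auto simp: rep_def Theta_objs_eq)
  define \<tau> where "\<tau> \<theta> e = free_ext X a (rep \<theta>) (\<beta> (rep \<theta>) e)" for \<theta> e
  define \<tau>' where "\<tau>' = (\<lambda>\<theta>\<in>Obj (full_subcat EM \<Theta>). \<lambda>e\<in>fobj P \<theta>. \<tau> \<theta> e)"
  have \<tau>_in: "\<tau> \<theta> e \<in> Hom EM \<theta> (X, a)" if "\<theta> \<in> \<Theta>" "e \<in> fobj P \<theta>" for \<theta> e
    using free_ext_in[OF alg, of "rep \<theta>" "\<beta> (rep \<theta>) e"] rep[OF that(1)] that by (simp add: \<tau>_def)
  have "\<tau>' \<in> Hom (presheaf_cat (full_subcat EM \<Theta>)) P (nerve_presheaf EM \<Theta> (X, a))"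
    unfolding \<tau>'_def
  proof (rule presheaf_homI[OF P nerve_EM_in[OF alg]])
    fix \<theta> e assume "\<theta> \<in> Obj (full_subcat EM \<Theta>)" "e \<in> fobj P \<theta>"
    then show "\<tau> \<theta> e \<in> fobj (nerve_presheaf EM \<Theta> (X, a)) \<theta>"
      using \<tau>_in by simp
  next
    fix \<theta> \<kappa> f e assume h: "\<theta> \<in> Obj (full_subcat EM \<Theta>)" "\<kappa> \<in> Obj (full_subcat EM \<Theta>)"
      "f \<in> Hom (full_subcat EM \<Theta>) \<kappa> \<theta>" "e \<in> fobj P \<theta>"
    define A where "A = rep \<theta>"
    define B where "B = rep \<kappa>"
    have A: "A \<in> S" "\<theta> = F A" and B: "B \<in> S" "\<kappa> = F B"
      using rep h by (simp_all add: A_def B_def)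
    have f: "f \<in> Hom EM (F B) (F A)" and e: "e \<in> fobj P (F A)"
      using h A B by simp_all
    define y where "y = Comp E B (T0 B) (T0 A) f (\<eta> B)"
    have y: "y \<in> Hom E B (T0 A)" "?hat A B y = f"
      using A B f free_ext_of_eta[of "T0 A" "\<mu> A" B f] by (simp_all add: y_def em_Hom)
    have x: "free_ext X a A (\<beta> A e) \<in> Hom EM (F A) (X, a)"
      using free_ext_in[OF alg] A e by simp
    have \<tau>\<theta>: "\<tau> \<theta> e = free_ext X a A (\<beta> A e)"
      by (simp add: \<tau>_def A_def)
    have "\<tau> \<kappa> (farr P \<theta> \<kappa> f e) = free_ext X a B (\<beta> B (act A B y e))"
      by (simp add: \<tau>_def act_def y flip: A(2) B(2) B_def)
    also have "\<dots> = free_ext X a B (Comp E B (T0 A) X (free_ext X a A (\<beta> A e)) y)"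
      using a_eq[of A e B y] A B X e y by (simp add: free_ext_def Comp_assoc)
    also have "\<dots> = Comp E (T0 B) (T0 A) X (free_ext X a A (\<beta> A e)) f"
      using free_ext_postcomp[OF _ alg x, of B y] A B y by simp
    also have "\<dots> = farr (nerve_presheaf EM \<Theta> (X, a)) \<theta> \<kappa> f (\<tau> \<theta> e)"
      unfolding \<tau>\<theta> using A B f x by simp
    finally show "\<tau> \<kappa> (farr P \<theta> \<kappa> f e) = farr (nerve_presheaf EM \<Theta> (X, a)) \<theta> \<kappa> f (\<tau> \<theta> e)" .
  qed
  moreover have "bij_betw (\<tau>' \<theta>) (fobj P \<theta>) (fobj (nerve_presheaf EM \<Theta> (X, a)) \<theta>)" if \<theta>: "\<theta> \<in> \<Theta>" for \<theta>
  proof -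
    have "bij_betw (\<tau> \<theta>) (fobj P \<theta>) (Hom EM \<theta> (X, a))"
      using bij_betw_trans[OF bij[OF rep(1)[OF \<theta>]] free_ext_bij[OF alg, of "rep \<theta>"]] rep[OF \<theta>]
      by (simp add: \<tau>_def[abs_def] comp_def)
    moreover have "bij_betw (\<tau>' \<theta>) (fobj P \<theta>) (Hom EM \<theta> (X, a)) \<longleftrightarrow> bij_betw (\<tau> \<theta>) (fobj P \<theta>) (Hom EM \<theta> (X, a))"
      by (rule bij_betw_cong) (use \<theta> in \<open>simp add: \<tau>'_def\<close>)
    ultimately show ?thesis using \<theta> by simp
  qed
  ultimately have "isomorphic (presheaf_cat (full_subcat EM \<Theta>)) P (nerve_presheaf EM \<Theta> (X, a))"
    unfolding presheaf_isomorphic_iff[OF P nerve_EM_in[OF alg]] by (intro bexI[where x = \<tau>'] ballI) simp_all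
  with alg show thesis by (rule that)
qed

end

lemma Obj_ess_image_nerve:
  "Obj (ess_image C (presheaf_cat A) (nerve C U)) =
    {Q \<in> Obj (presheaf_cat A). \<exists>x\<in>Obj C. isomorphic (presheaf_cat A) Q (nerve_presheaf C U x)}"
  by (auto simp: ess_image_def nerve_def)

lemma ess_image_nerve_EM:
  "ess_image EM (presheaf_cat (Theta E S T)) (nerve EM \<Theta>) =
    full_subcat (presheaf_cat (Theta E S T)) {P \<in> Obj (presheaf_cat (Theta E S T)).
      res P \<in> Obj (ess_image E (presheaf_cat (full_subcat E S)) (nerve E S))}"
proof -
  have "(\<exists>x\<in>Obj EM. isomorphic (presheaf_cat (Theta E S T)) P (nerve_presheaf EM \<Theta> x)) \<longleftrightarrow>
      res P \<in> Obj (ess_image E (presheaf_cat (full_subcat E S)) (nerve E S))"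
    if P: "P \<in> Obj (presheaf_cat (Theta E S T))" for P
  proof
    assume "\<exists>x\<in>Obj EM. isomorphic (presheaf_cat (Theta E S T)) P (nerve_presheaf EM \<Theta> x)"
    then obtain X a where "(X, a) \<in> Obj EM"
      "isomorphic (presheaf_cat (Theta E S T)) P (nerve_presheaf EM \<Theta> (X, a))"
      by auto
    then show "res P \<in> Obj (ess_image E (presheaf_cat (full_subcat E S)) (nerve E S))"
      using restriction_represented P res_in unfolding Theta_eq Obj_ess_image_nerve
      by (auto simp: em_Obj)
  next
    assume "res P \<in> Obj (ess_image E (presheaf_cat (full_subcat E S)) (nerve E S))"
    then obtain X where "X \<in> Obj E"
      "isomorphic (presheaf_cat (full_subcat E S)) (res P) (nerve_presheaf E S X)"
      unfolding Obj_ess_image_nerve by auto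
    then show "\<exists>x\<in>Obj EM. isomorphic (presheaf_cat (Theta E S T)) P (nerve_presheaf EM \<Theta> x)"
      using restriction_representedD P unfolding Theta_eq by metis
  qed
  then show ?thesis
    unfolding ess_image_def[of EM] by (auto simp: nerve_def intro!: arg_cong[of _ _ "full_subcat _"])
qed

end

theorem theorem1p10:
  fixes E :: "('o, 'u) cat" and \<A> :: "'o set" and T :: "('o, 'u) monad_data"
  assumes "dense_generator E \<A>" and "monad_with_arities E \<A> T"
  shows "dense_generator (em_cat E T) (Theta_objs E \<A> T) \<and>
    ess_image (em_cat E T) (presheaf_cat (Theta E \<A> T)) (nerve (em_cat E T) (Theta_objs E \<A> T))
    = full_subcat (presheaf_cat (Theta E \<A> T))
        {P \<in> Obj (presheaf_cat (Theta E \<A> T)).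
           restrict_presheaf (full_subcat E \<A>) (theory_functor E \<A> T) P
           \<in> Obj (ess_image E (presheaf_cat (full_subcat E \<A>)) (nerve E \<A>))}"
proof -
  have "monad E T" using assms(2) by (simp add: monad_with_arities_def)
  then interpret arities_monad E T \<A>
    by (intro arities_monad.intro monad_on_category arities_monad_axioms.intro assms)
  show ?thesis using dense_Theta ess_image_nerve_EM by blast
qed

end
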